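(* Fix a prime power $q$ and an integer $k\ge1$. For every $\delta>0$ there exists a constant $c(\delta)>0$ such that for every $N\ge k$ and every function $\phi:\mathbb{F}_{q^N}\to\mathbb{R}$ with $0\le\phi(x)\le1$ for all $x$ and $\mathbb{E}(\phi\mid \mathbb{F}_{q^N})\ge\delta$, we have $$\mathbb{E}\Big(\prod_{P\in\mathbf{G}_k}\phi(f+Pg)\ \Big|\ f,g\in\mathbb{F}_{q^N}\Big)\ge c(\delta).$$
   Context: $\mathbf{G}_N$ denotes the set of polynomials in $\mathbb{F}_q[t]$ of degree less than $N$. For each $N$ a monic irreducible polynomial $f_N\in\mathbb{F}_q[t]$ of degree $N$ is fixed, and $\mathbb{F}_{q^N}$ denotes the additive group $\mathbf{G}_N$ endowed with multiplication modulo $f_N$ (a field with $q^N$ elements); for $N\ge k$, $\mathbf{G}_k\subseteq\mathbf{G}_N=\mathbb{F}_{q^N}$. $\mathbb{E}(\cdot\mid A)$ denotes the average over the finite set $A$. *)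

theory Defs
  imports "HOL-Computational_Algebra.Computational_Algebra"
begin

definition Gdeg :: "nat \<Rightarrow> 'a::zero poly set" where
  "Gdeg N = {p. p = 0 \<or> degree p < N}"

definition avg :: "('b \<Rightarrow> real) \<Rightarrow> 'b set \<Rightarrow> real" where
  "avg h A = (\<Sum>x\<in>A. h x) / real (card A)"

end

(*
The theorem is deduced from the density Hales-Jewett theorem over an alphabet enumerating G_k.
Choose f, g_1, ..., g_m at random and send a word z to f + sum_j z_j g_j (mod f_N). Every single
value is uniformly distributed, and a combinatorial line goes to a set {f' + P g' : P in G_k} with
f' and g' independent and uniform, so a line that lies in the pull-back of {phi >= delta/2} with
probability bounded below gives the bound.

Density Hales-Jewett is proved by induction on the alphabet, in the spirit of Polymath and of
Dodos, Kanellopoulos and Tyros. Let delta be the limiting maximal density of a line-free set over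
k + 1 letters. If a set on words of length L + M is line-free and nearly extremal with M huge, all
its L-prefix sections have density almost delta, so any law whatsoever may be used for the prefix.
The theorem for k letters then produces a product law for which the set avoids a dense
intersection D of sets C_i, each insensitive to exchanging the last letter with the letter i.
The complement of D splits into intersections of insensitive sets, on one of which the set is too
dense; but insensitive sets are essentially unions of large subspaces, where line-free sets have
density at most delta + o(1).
*)

theory Submission
  imports Defs
begin

section \<open>Averages\<close>

lemma avg_mono:
  assumes "\<And>x. x \<in> S \<Longrightarrow> f x \<le> g x"
  shows "avg f S \<le> avg g S"
  unfolding avg_def by (intro divide_right_mono sum_mono assms) auto

lemma avg_cong:
  assumes "\<And>x. x \<in> S \<Longrightarrow> f x = g x"
  shows "avg f S = avg g S"
  unfolding avg_def using assms by simp

lemma avg_const: "finite S \<Longrightarrow> S \<noteq> {} \<Longrightarrow> avg (\<lambda>_. c) S = c"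
  by (simp add: avg_def)

lemma avg_le_const:
  assumes "finite S" "S \<noteq> {}" "\<And>x. x \<in> S \<Longrightarrow> f x \<le> c"
  shows "avg f S \<le> c"
  using avg_mono[of S f "\<lambda>_. c"] assms by (simp add: avg_const)

lemma avg_ge_const:
  assumes "finite S" "S \<noteq> {}" "\<And>x. x \<in> S \<Longrightarrow> c \<le> f x"
  shows "c \<le> avg f S"
  using avg_mono[of S "\<lambda>_. c" f] assms by (simp add: avg_const)

lemma avg_add: "avg (\<lambda>x. f x + g x) S = avg f S + avg g S"
  by (simp add: avg_def sum.distrib add_divide_distrib)

lemma avg_diff: "avg (\<lambda>x. f x - g x) S = avg f S - avg g S"
  by (simp add: avg_def sum_subtractf diff_divide_distrib)

lemma avg_cmult: "avg (\<lambda>x. c * f x) S = c * avg f S"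
  by (simp add: avg_def sum_distrib_left)

lemma avg_sum: "avg (\<lambda>x. \<Sum>i\<in>I. f i x) S = (\<Sum>i\<in>I. avg (f i) S)"
  unfolding avg_def by (subst sum.swap) (simp add: sum_divide_distrib)

lemma avg_swap: "avg (\<lambda>x. avg (f x) T) S = avg (\<lambda>y. avg (\<lambda>x. f x y) S) T"
  unfolding avg_def
  by (simp add: sum_divide_distrib[symmetric] sum.swap[of _ S T])

lemma avg_times: "avg f (S \<times> T) = avg (\<lambda>x. avg (\<lambda>y. f (x, y)) T) S"
  unfolding avg_def
  using sum.cartesian_product[of "\<lambda>x y. f (x, y)" T S]
  by (simp add: sum_divide_distrib[symmetric] card_cartesian_product field_simps)

lemma avg_of_bool: "finite S \<Longrightarrow> avg (\<lambda>x. of_bool (P x)) S = card {x \<in> S. P x} / card S"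
  by (simp add: avg_def of_bool_def sum.If_cases Int_def)

text \<open>All other values are at most \<open>a\<close>, so one value falling short by more than
  \<open>c * card S\<close> would pull the mean below \<open>a - c\<close>. This turns a nearly
  extremal average into a bound for every single section.\<close>

lemma avg_bounded_above_pointwise:
  assumes "finite S" "\<And>x. x \<in> S \<Longrightarrow> f x \<le> a" "a - c \<le> avg f S" "z \<in> S"
  shows "a - c * card S \<le> f z"
proof -
  have pos: "real (card S) > 0" using assms by (auto simp: card_gt_0_iff)
  have "(a - c) * card S \<le> sum f S"
    using assms(3) pos by (simp add: avg_def field_simps)
  also have "sum f S = f z + sum f (S - {z})" using assms by (simp add: sum.remove)
  also have "sum f (S - {z}) \<le> (\<Sum>x\<in>S - {z}. a)" by (intro sum_mono) (use assms in auto)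
  also have "\<dots> = (real (card S) - 1) * a"
    using assms pos by (simp add: card_Diff_singleton of_nat_diff)
  finally show ?thesis by (simp add: algebra_simps)
qed

section \<open>Words and templates\<close>

definition words :: "nat \<Rightarrow> nat \<Rightarrow> nat list set" where
  "words K n = {xs. set xs \<subseteq> {..<K} \<and> length xs = n}"

text \<open>Letters \<open>a < k\<close> of a template over \<open>k + d\<close> are constants, and \<open>k + i\<close> is its \<open>i\<close>-th variable.\<close>

definition inst :: "nat \<Rightarrow> nat list \<Rightarrow> nat list \<Rightarrow> nat list" where
  "inst k t y = map (\<lambda>a. if a < k then a else t ! (a - k)) y"

text \<open>The occurrence condition rules out degenerate templates, so these are combinatorial
  subspaces, and combinatorial lines for \<open>d = 1\<close>.\<close>

definition tmpl :: "nat \<Rightarrow> nat \<Rightarrow> nat \<Rightarrow> nat list set" where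
  "tmpl k d m = {y \<in> words (k + d) m. {k..<k + d} \<subseteq> set y}"

lemma finite_words [simp]: "finite (words K n)"
  unfolding words_def by (rule finite_lists_length_eq) auto

lemma card_words [simp]: "card (words K n) = K ^ n"
  unfolding words_def using card_lists_length_eq[of "{..<K}" n] by simp

lemma words_nonempty [simp]: "0 < K \<Longrightarrow> words K n \<noteq> {}"
proof -
  assume "0 < K"
  then have "replicate n 0 \<in> words K n" by (auto simp: words_def)
  then show ?thesis by blast
qed

lemma finite_tmpl [simp]: "finite (tmpl k d m)"
  by (rule finite_subset[OF _ finite_words]) (auto simp: tmpl_def)

lemma words_mono: "K \<le> K' \<Longrightarrow> x \<in> words K n \<Longrightarrow> x \<in> words K' n"
  by (auto simp: words_def)

lemma words_append: "x \<in> words K a \<Longrightarrow> y \<in> words K b \<Longrightarrow> x @ y \<in> words K (a + b)"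
  by (auto simp: words_def)

lemma words_one: "words K 1 = (\<lambda>i. [i]) ` {..<K}"
  by (auto simp: words_def length_Suc_conv image_def)

lemma words_nth: "x \<in> words K n \<Longrightarrow> i < n \<Longrightarrow> x ! i < K"
  unfolding words_def using nth_mem by fastforce

lemma bij_words_append:
  "bij_betw (\<lambda>(x, y). x @ y) (words K a \<times> words K b) (words K (a + b))"
proof (rule bij_betwI[where g = "\<lambda>w. (take a w, drop a w)"])
  show "(\<lambda>w. (take a w, drop a w)) \<in> words K (a + b) \<rightarrow> words K a \<times> words K b"
    by (auto simp: words_def dest: in_set_takeD in_set_dropD)
qed (auto simp: words_def)

lemma avg_words_append:
  "avg f (words K (a + b)) = avg (\<lambda>x. avg (\<lambda>y. f (x @ y)) (words K b)) (words K a)"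
proof -
  have "avg f (words K (a + b)) = avg (\<lambda>p. f (fst p @ snd p)) (words K a \<times> words K b)"
    unfolding avg_def
    by (simp add: sum.reindex_bij_betw[OF bij_words_append, symmetric] case_prod_beta
        card_cartesian_product power_add)
  then show ?thesis by (simp add: avg_times)
qed

section \<open>Substitution into templates and composition of subspaces\<close>

lemma length_inst [simp]: "length (inst k t y) = length y"
  by (simp add: inst_def)

lemma inst_append: "inst k t (x @ y) = inst k t x @ inst k t y"
  by (simp add: inst_def)

lemma inst_id: "x \<in> words k n \<Longrightarrow> inst k t x = x"
  unfolding inst_def by (rule map_idI) (auto simp: words_def)

text \<open>A word over \<open>Suc k\<close> letters doubles as a template over \<open>k\<close>
  letters whose only variable, if present, is \<open>k\<close>; putting \<open>k\<close> back
  changes nothing.\<close>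

lemma inst_same: "x \<in> words (Suc k) n \<Longrightarrow> inst k [k] x = x"
  unfolding inst_def by (rule map_idI) (auto simp: words_def)

lemma inst_words:
  assumes "y \<in> words (k + d) m" "t \<in> words K d" "k \<le> K"
  shows "inst k t y \<in> words K m"
proof -
  have "(if a < k then a else t ! (a - k)) < K" if "a \<in> set y" for a
  proof -
    have "a < k + d" using that assms(1) by (auto simp: words_def)
    then show ?thesis using words_nth[OF assms(2), of "a - k"] assms(3) by auto
  qed
  then have "set (inst k t y) \<subseteq> {..<K}" unfolding inst_def by fastforce
  then show ?thesis using assms(1) by (simp add: words_def)
qed

text \<open>Constants of \<open>y\<close> lie below \<open>k \<le> k'\<close>, so the second
  substitution fixes them and acts only on the entries of \<open>s\<close>.\<close>

lemma inst_inst: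
  assumes "y \<in> words (k + d) m" "length s = d" "k \<le> k'"
  shows "inst k' t (inst k s y) = inst k (inst k' t s) y"
proof -
  have "a < k \<or> a - k < length s" if "a \<in> set y" for a
    using that assms(1,2) by (auto simp: words_def)
  then show ?thesis using assms(3) by (fastforce simp: inst_def nth_map)
qed

lemma inst_singleton_words:
  "x \<in> words (Suc k) n \<Longrightarrow> i < K \<Longrightarrow> k \<le> K \<Longrightarrow> inst k [i] x \<in> words K n"
  by (rule inst_words[where d = 1]) (auto simp: words_def)

lemma inst_singleton_twice:
  assumes "x \<in> words (Suc k) n" "i < k"
  shows "inst k [j] (inst k [i] x) = inst k [i] x"
  using inst_id[OF inst_singleton_words[OF assms]] by simp

text \<open>Every variable occurs in a template, so each entry of \<open>t\<close> can be read off
  at a position of its variable.\<close>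

lemma inst_inj:
  assumes "y \<in> tmpl k d m"
  shows "inj_on (\<lambda>t. inst k t y) (words K d)"
proof (rule inj_onI)
  fix s t assume st: "s \<in> words K d" "t \<in> words K d" and eq: "inst k s y = inst k t y"
  show "s = t"
  proof (rule nth_equalityI)
    show "length s = length t" using st by (simp add: words_def)
    fix i assume "i < length s"
    then have "k + i \<in> set y" using assms st by (auto simp: tmpl_def words_def)
    then have "s ! (k + i - k) = t ! (k + i - k)"
      using eq unfolding inst_def map_eq_conv by fastforce
    then show "s ! i = t ! i" by simp
  qed
qed

lemma tmpl_sub_words: "y \<in> tmpl k d m \<Longrightarrow> y \<in> words (k + d) m"
  by (simp add: tmpl_def)

text \<open>No variable is lost: a variable of \<open>s\<close> sits at some position
  \<open>i\<close>, and the variable \<open>k + i\<close> of \<open>y\<close> carries it into the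
  composite.\<close>

lemma tmpl_inst:
  assumes "y \<in> tmpl k d m" "s \<in> tmpl k' e d" "k \<le> k'"
  shows "inst k s y \<in> tmpl k' e m"
proof -
  have "inst k s y \<in> words (k' + e) m"
    using assms by (intro inst_words[where d = d]) (auto simp: tmpl_def)
  moreover have "v \<in> set (inst k s y)" if "v \<in> {k'..<k' + e}" for v
  proof -
    have "v \<in> set s" using that assms(2) by (auto simp: tmpl_def)
    then obtain i where i: "i < length s" "s ! i = v" by (auto simp: in_set_conv_nth)
    then have "k + i \<in> set y" using assms(1,2) by (auto simp: tmpl_def words_def)
    then have "(if k + i < k then k + i else s ! (k + i - k)) \<in> set (inst k s y)"
      unfolding inst_def by force
    then show ?thesis using i by simp
  qed
  ultimately show ?thesis by (auto simp: tmpl_def)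
qed

section \<open>Multidimensional and probabilistic forms\<close>

text \<open>Density Hales-Jewett for \<open>d\<close>-dimensional subspaces. One suitable length
  \<open>m\<close>, rather than all large ones, is enough for the induction on the alphabet.\<close>

definition dhj :: "nat \<Rightarrow> nat \<Rightarrow> bool" where
  "dhj k d \<longleftrightarrow> (\<forall>\<delta>>0. \<exists>m. \<forall>A. \<delta> \<le> avg (\<lambda>x. of_bool (x \<in> A)) (words k m) \<longrightarrow>
     (\<exists>y\<in>tmpl k d m. \<forall>t\<in>words k d. inst k t y \<in> A))"

text \<open>For each \<omega> the words \<open>z\<close> with \<open>\<omega> \<in> E z\<close> form
  a set, which contains a subspace if it is dense. There are finitely many templates, so one of them
  serves many \<omega>. The type of \<open>\<Omega>\<close> is free because words, pairs of words
  and tuples of polynomials all serve as sample points.\<close>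

lemma dhj_prob:
  assumes "dhj k d" "1 \<le> k" "\<delta> > 0"
  shows "\<exists>m. \<exists>\<theta>>0. \<forall>(\<Omega> :: 'w set) E. finite \<Omega> \<longrightarrow> \<Omega> \<noteq> {} \<longrightarrow>
       \<delta> \<le> avg (\<lambda>z. avg (\<lambda>\<omega>. of_bool (\<omega> \<in> E z)) \<Omega>) (words k m) \<longrightarrow>
       (\<exists>y\<in>tmpl k d m. \<theta> \<le> avg (\<lambda>\<omega>. of_bool (\<forall>t\<in>words k d. \<omega> \<in> E (inst k t y))) \<Omega>)"
proof -
  obtain m where m: "\<And>A. \<delta> / 2 \<le> avg (\<lambda>x. of_bool (x \<in> A)) (words k m) \<Longrightarrow>
     \<exists>y\<in>tmpl k d m. \<forall>t\<in>words k d. inst k t y \<in> A"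
    using assms(1,3) unfolding dhj_def by (metis half_gt_zero)
  \<comment> \<open>Sparse \<omega> use up half of \<delta>; the other half is shared among at most
    \<open>(k + d) ^ m\<close> templates.\<close>
  define \<theta> where "\<theta> = \<delta> / 2 / real ((k + d) ^ m)"
  have Kpos: "real ((k + d) ^ m) > 0" using assms(2) by simp
  show ?thesis
  proof (intro exI[of _ m] exI[of _ \<theta>] conjI allI impI)
    show \<theta>: "\<theta> > 0" using assms(3) Kpos by (simp add: \<theta>_def)
    fix \<Omega> :: "'w set" and E
    assume fin: "finite \<Omega>" and ne: "\<Omega> \<noteq> {}"
      and dense: "\<delta> \<le> avg (\<lambda>z. avg (\<lambda>\<omega>. of_bool (\<omega> \<in> E z)) \<Omega>) (words k m)"
    let ?good = "\<lambda>y \<omega>. \<forall>t\<in>words k d. \<omega> \<in> E (inst k t y)"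
    have pt: "avg (\<lambda>z. of_bool (\<omega> \<in> E z)) (words k m) \<le>
        \<delta> / 2 + (\<Sum>y\<in>tmpl k d m. of_bool (?good y \<omega>))" for \<omega>
    proof (cases "\<delta> / 2 \<le> avg (\<lambda>z. of_bool (z \<in> {z. \<omega> \<in> E z})) (words k m)")
      case True
      then obtain y where y: "y \<in> tmpl k d m" "?good y \<omega>" using m by blast
      have "avg (\<lambda>z. of_bool (\<omega> \<in> E z)) (words k m) \<le> 1"
        using assms(2) by (intro avg_le_const) auto
      also have "(1::real) \<le> (\<Sum>y\<in>tmpl k d m. of_bool (?good y \<omega>))"
        using y member_le_sum[of y "tmpl k d m" "\<lambda>y. of_bool (?good y \<omega>) :: real"] by auto
      finally show ?thesis using assms(3) by linarith
    next
      case False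
      then have "avg (\<lambda>z. of_bool (\<omega> \<in> E z)) (words k m) \<le> \<delta> / 2" by simp
      moreover have "(0::real) \<le> (\<Sum>y\<in>tmpl k d m. of_bool (?good y \<omega>))"
        by (intro sum_nonneg) auto
      ultimately show ?thesis by linarith
    qed
    have "\<delta> \<le> avg (\<lambda>\<omega>. \<delta> / 2 + (\<Sum>y\<in>tmpl k d m. of_bool (?good y \<omega>))) \<Omega>"
      using dense pt avg_mono[of \<Omega>] unfolding avg_swap[of _ \<Omega>] by (meson order_trans)
    also have "\<dots> = \<delta> / 2 + (\<Sum>y\<in>tmpl k d m. avg (\<lambda>\<omega>. of_bool (?good y \<omega>)) \<Omega>)"
      unfolding avg_add avg_sum using fin ne by (simp add: avg_const)
    finally have sum: "\<delta> / 2 \<le> (\<Sum>y\<in>tmpl k d m. avg (\<lambda>\<omega>. of_bool (?good y \<omega>)) \<Omega>)"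
      by simp
    show "\<exists>y\<in>tmpl k d m. \<theta> \<le> avg (\<lambda>\<omega>. of_bool (?good y \<omega>)) \<Omega>"
    proof (rule ccontr)
      assume "\<not> ?thesis"
      then have lt: "avg (\<lambda>\<omega>. of_bool (?good y \<omega>)) \<Omega> < \<theta>" if "y \<in> tmpl k d m" for y
        using that by force
      have "tmpl k d m \<noteq> {}" using sum assms(3) by auto
      then have "(\<Sum>y\<in>tmpl k d m. avg (\<lambda>\<omega>. of_bool (?good y \<omega>)) \<Omega>) < (\<Sum>y\<in>tmpl k d m. \<theta>)"
        using lt by (intro sum_strict_mono) auto
      also have "\<dots> = real (card (tmpl k d m)) * \<theta>" by simp
      also have "\<dots> \<le> real ((k + d) ^ m) * \<theta>"
      proof -
        have "card (tmpl k d m) \<le> card (words (k + d) m)"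
          by (intro card_mono) (auto simp: tmpl_def)
        then have "real (card (tmpl k d m)) \<le> real ((k + d) ^ m)"
          unfolding card_words of_nat_le_iff .
        then show ?thesis using \<theta> by (intro mult_right_mono) auto
      qed
      also have "\<dots> = \<delta> / 2" using assms(2) unfolding \<theta>_def by (simp del: of_nat_power)
      finally show False using sum by simp
    qed
  qed
qed

text \<open>Induction on \<open>d\<close>: with the tail of the word as the random parameter,
  \<open>dhj_prob\<close> gives one prefix template with \<open>d\<close> variables that works for a
  dense set of tails, and a line among these tails supplies the last variable.\<close>

lemma dhj_multidim:
  assumes "dhj k 1" "1 \<le> k"
  shows "dhj k d"
proof (induction d)
  case 0
  show ?case unfolding dhj_def
  proof (intro allI impI exI[of _ 0])
    fix \<delta> :: real and A
    assume "\<delta> > 0" "\<delta> \<le> avg (\<lambda>x. of_bool (x \<in> A)) (words k 0)"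
    moreover have "words k 0 = {[]}" by (auto simp: words_def)
    ultimately have "[] \<in> A" by (intro ccontr[of "[] \<in> A"]) (simp add: avg_def)
    then show "\<exists>y\<in>tmpl k 0 0. \<forall>t\<in>words k 0. inst k t y \<in> A"
      by (intro bexI[of _ "[]"]) (auto simp: tmpl_def words_def inst_def)
  qed
next
  case (Suc d)
  show ?case unfolding dhj_def
  proof (intro allI impI)
    fix \<delta> :: real assume "\<delta> > 0"
    obtain m \<theta> where \<theta>: "\<theta> > 0" and m:
      "\<forall>(\<Omega> :: nat list set) E. finite \<Omega> \<longrightarrow> \<Omega> \<noteq> {} \<longrightarrow>
       \<delta> \<le> avg (\<lambda>z. avg (\<lambda>\<omega>. of_bool (\<omega> \<in> E z)) \<Omega>) (words k m) \<longrightarrow>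
       (\<exists>y\<in>tmpl k d m. \<theta> \<le> avg (\<lambda>\<omega>. of_bool (\<forall>t\<in>words k d. \<omega> \<in> E (inst k t y))) \<Omega>)"
      using dhj_prob[OF Suc.IH assms(2) \<open>\<delta> > 0\<close>] by iprover
    obtain m' where m': "\<And>A. \<theta> \<le> avg (\<lambda>x. of_bool (x \<in> A)) (words k m') \<Longrightarrow>
     \<exists>y\<in>tmpl k 1 m'. \<forall>t\<in>words k 1. inst k t y \<in> A"
      using assms(1) \<theta> unfolding dhj_def by metis
    show "\<exists>m. \<forall>A. \<delta> \<le> avg (\<lambda>x. of_bool (x \<in> A)) (words k m) \<longrightarrow>
     (\<exists>y\<in>tmpl k (Suc d) m. \<forall>t\<in>words k (Suc d). inst k t y \<in> A)"
    proof (intro exI[of _ "m + m'"] allI impI)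
      fix A assume A: "\<delta> \<le> avg (\<lambda>x. of_bool (x \<in> A)) (words k (m + m'))"
      have "\<delta> \<le> avg (\<lambda>z. avg (\<lambda>w. of_bool (w \<in> {w. z @ w \<in> A})) (words k m')) (words k m)"
        using A by (simp add: avg_words_append)
      from m[rule_format, OF _ _ this] assms(2) obtain y where y: "y \<in> tmpl k d m" and
        "\<theta> \<le> avg (\<lambda>w. of_bool (w \<in> {w. \<forall>t\<in>words k d. inst k t y @ w \<in> A})) (words k m')"
        by auto
      from m'[OF this(2)] obtain u where u: "u \<in> tmpl k 1 m'"
        and uA: "\<And>s t. s \<in> words k 1 \<Longrightarrow> t \<in> words k d \<Longrightarrow> inst k t y @ inst k s u \<in> A"
        by blast
      \<comment> \<open>The variable of the line is renamed from \<open>k\<close> to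
        \<open>k + d\<close>, since the prefix template already uses \<open>k\<close> to
        \<open>k + d - 1\<close>.\<close>
      define u' where "u' = inst k [k + d] u"
      have u'w: "u' \<in> words (k + Suc d) m'"
        unfolding u'_def using u by (intro inst_singleton_words) (auto simp: tmpl_def)
      have "k \<in> set u" using u by (auto simp: tmpl_def)
      then have "k + d \<in> set u'" unfolding u'_def inst_def by (auto intro!: image_eqI[of _ _ k])
      moreover have "{k..<k + d} \<subseteq> set y" using y by (simp add: tmpl_def)
      moreover have "{k..<k + Suc d} = insert (k + d) {k..<k + d}" by auto
      ultimately have yu: "y @ u' \<in> tmpl k (Suc d) (m + m')"
        using u'w words_append[OF words_mono[OF _ tmpl_sub_words[OF y]] u'w]
        by (auto simp: tmpl_def)
      show "\<exists>y\<in>tmpl k (Suc d) (m + m'). \<forall>t\<in>words k (Suc d). inst k t y \<in> A"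
      proof (intro bexI[OF _ yu] ballI)
        fix t assume t: "t \<in> words k (Suc d)"
        have "inst k t u' = inst k [t ! d] u"
          using u t unfolding u'_def by (subst inst_inst[of _ _ 1 m']) (auto simp: tmpl_def inst_def)
        moreover have "inst k t y = inst k (take d t) y"
          unfolding inst_def
        proof (rule map_cong[OF refl])
          fix a assume "a \<in> set y"
          then have "a < k + d" using y by (auto simp: tmpl_def words_def)
          then show "(if a < k then a else t ! (a - k)) = (if a < k then a else take d t ! (a - k))"
            by auto
        qed
        moreover have "take d t \<in> words k d" "[t ! d] \<in> words k 1"
          using t words_nth[OF t, of d] by (auto simp: words_def dest: in_set_takeD)
        ultimately show "inst k t (y @ u') \<in> A" using uA by (simp add: inst_append)
      qed
    qed
  qed
qed


section \<open>Line-free and insensitive sets\<close>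

definition line_free :: "nat \<Rightarrow> nat \<Rightarrow> nat list set \<Rightarrow> bool" where
  "line_free K n A \<longleftrightarrow> \<not> (\<exists>y\<in>tmpl K 1 n. \<forall>t\<in>words K 1. inst K t y \<in> A)"

text \<open>Replacing all \<open>k\<close> by \<open>i\<close> at once expresses the usual
  insensitivity: words that differ only by exchanges of \<open>i\<close> and \<open>k\<close> have
  the same image.\<close>

definition insens :: "nat \<Rightarrow> nat \<Rightarrow> nat \<Rightarrow> nat list set \<Rightarrow> bool" where
  "insens k i n F \<longleftrightarrow> (\<forall>x\<in>words (Suc k) n. inst k [i] x \<in> F \<longleftrightarrow> x \<in> F)"

lemma line_free_left:
  assumes "line_free K (a + b) A" "z \<in> words K a"
  shows "line_free K b {w. z @ w \<in> A}"
  unfolding line_free_def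
proof
  assume "\<exists>y\<in>tmpl K 1 b. \<forall>t\<in>words K 1. inst K t y \<in> {w. z @ w \<in> A}"
  then obtain y where y: "y \<in> tmpl K 1 b" "\<And>t. t \<in> words K 1 \<Longrightarrow> z @ inst K t y \<in> A" by blast
  have "z @ y \<in> tmpl K 1 (a + b)"
    using y(1) words_append[OF words_mono[OF _ assms(2)] tmpl_sub_words[OF y(1)]]
    by (auto simp: tmpl_def)
  moreover have "inst K t (z @ y) \<in> A" if "t \<in> words K 1" for t
    using y(2)[OF that] inst_id[OF assms(2)] by (simp add: inst_append)
  ultimately show False using assms(1) unfolding line_free_def by blast
qed

lemma line_free_right:
  assumes "line_free K (a + b) A" "w \<in> words K b"
  shows "line_free K a {z. z @ w \<in> A}"
  unfolding line_free_def
proof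
  assume "\<exists>y\<in>tmpl K 1 a. \<forall>t\<in>words K 1. inst K t y \<in> {z. z @ w \<in> A}"
  then obtain y where y: "y \<in> tmpl K 1 a" "\<And>t. t \<in> words K 1 \<Longrightarrow> inst K t y @ w \<in> A" by blast
  have "y @ w \<in> tmpl K 1 (a + b)"
    using y(1) words_append[OF tmpl_sub_words[OF y(1)] words_mono[OF _ assms(2)]]
    by (auto simp: tmpl_def)
  moreover have "inst K t (y @ w) \<in> A" if "t \<in> words K 1" for t
    using y(2)[OF that] inst_id[OF assms(2)] by (simp add: inst_append)
  ultimately show False using assms(1) unfolding line_free_def by blast
qed

lemma line_free_subspace:
  assumes "line_free K n A" "y \<in> tmpl k d n" "k \<le> K"
  shows "line_free K d {t. inst k t y \<in> A}"
  unfolding line_free_def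
proof
  assume "\<exists>s\<in>tmpl K 1 d. \<forall>t\<in>words K 1. inst K t s \<in> {t. inst k t y \<in> A}"
  then obtain s where s: "s \<in> tmpl K 1 d" "\<And>t. t \<in> words K 1 \<Longrightarrow> inst k (inst K t s) y \<in> A"
    by blast
  have "inst K t (inst k s y) = inst k (inst K t s) y" for t
    using assms s by (intro inst_inst[of _ _ d n]) (auto simp: tmpl_def words_def)
  then show False
    using assms(1) s(2) tmpl_inst[OF assms(2) s(1) assms(3)] unfolding line_free_def by metis
qed

text \<open>The prefix \<open>z\<close> may itself contain \<open>k\<close> and be changed by the
  substitution. Hence \<open>z @ x\<close> and \<open>z @ inst k [i] x\<close> are compared through
  their common image.\<close>

lemma insens_left:
  assumes "insens k i (a + b) F" "z \<in> words (Suc k) a" "i < k"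
  shows "insens k i b {w. z @ w \<in> F}"
  unfolding insens_def
proof
  fix x assume x: "x \<in> words (Suc k) b"
  have x': "inst k [i] x \<in> words (Suc k) b"
    using x assms(3) by (intro inst_singleton_words) auto
  show "inst k [i] x \<in> {w. z @ w \<in> F} \<longleftrightarrow> x \<in> {w. z @ w \<in> F}"
    using assms(1)[unfolded insens_def, rule_format, OF words_append[OF assms(2) x]]
      assms(1)[unfolded insens_def, rule_format, OF words_append[OF assms(2) x']]
      inst_singleton_twice[OF x assms(3)]
    by (simp add: inst_append)
qed

lemma insens_right:
  assumes "insens k i (a + b) F" "w \<in> words (Suc k) b" "i < k"
  shows "insens k i a {z. z @ w \<in> F}"
  unfolding insens_def
proof
  fix x assume x: "x \<in> words (Suc k) a"
  have x': "inst k [i] x \<in> words (Suc k) a"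
    using x assms(3) by (intro inst_singleton_words) auto
  show "inst k [i] x \<in> {z. z @ w \<in> F} \<longleftrightarrow> x \<in> {z. z @ w \<in> F}"
    using assms(1)[unfolded insens_def, rule_format, OF words_append[OF x assms(2)]]
      assms(1)[unfolded insens_def, rule_format, OF words_append[OF x' assms(2)]]
      inst_singleton_twice[OF x assms(3)]
    by (simp add: inst_append)
qed

lemma inst_words_tmpl:
  "y \<in> tmpl k d n \<Longrightarrow> t \<in> words K d \<Longrightarrow> k \<le> K \<Longrightarrow> inst k t y \<in> words K n"
  by (blast intro: inst_words tmpl_sub_words)

lemma insens_subspace:
  assumes "insens k i n F" "y \<in> tmpl k d n"
  shows "insens k i d {t. inst k t y \<in> F}"
  unfolding insens_def
proof
  fix t assume t: "t \<in> words (Suc k) d"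
  have "inst k (inst k [i] t) y = inst k [i] (inst k t y)"
    using assms(2) t by (intro inst_inst[of _ _ d n, symmetric]) (auto simp: tmpl_def words_def)
  moreover have "inst k t y \<in> words (Suc k) n"
    using assms(2) t by (intro inst_words_tmpl) auto
  ultimately show "inst k [i] t \<in> {t. inst k t y \<in> F} \<longleftrightarrow> t \<in> {t. inst k t y \<in> F}"
    using assms(1) by (simp add: insens_def)
qed

section \<open>Configurations of a line-free set with insensitive sets, and their gap\<close>

definition config :: "nat \<Rightarrow> nat \<Rightarrow> nat \<Rightarrow> nat list set \<Rightarrow> (nat \<Rightarrow> nat list set) \<Rightarrow> bool" where
  "config k j n A F \<longleftrightarrow> line_free (Suc k) n A \<and> (\<forall>i<j. insens k i n (F i))"

text \<open>With \<open>\<delta>\<close> the critical density, the average of \<open>gap\<close> measures by how much \<open>A\<close> is too dense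
  on the intersection of the insensitive sets \<open>F i\<close>.\<close>

definition gap :: "real \<Rightarrow> nat \<Rightarrow> nat list set \<Rightarrow> (nat \<Rightarrow> nat list set) \<Rightarrow> nat list \<Rightarrow> real" where
  "gap \<delta> j A F x = of_bool (x \<in> A \<and> (\<forall>i<j. x \<in> F i)) - \<delta> * of_bool (\<forall>i<j. x \<in> F i)"

lemma config_left:
  assumes "config k j (a + b) A F" "z \<in> words (Suc k) a" "j \<le> k"
  shows "config k j b {w. z @ w \<in> A} (\<lambda>i. {w. z @ w \<in> F i})"
  using assms by (auto simp: config_def intro!: line_free_left insens_left)

lemma config_right:
  assumes "config k j (a + b) A F" "w \<in> words (Suc k) b" "j \<le> k"
  shows "config k j a {z. z @ w \<in> A} (\<lambda>i. {z. z @ w \<in> F i})"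
  using assms by (auto simp: config_def intro!: line_free_right insens_right)

lemma config_subspace:
  assumes "config k j n A F" "y \<in> tmpl k d n"
  shows "config k j d {t. inst k t y \<in> A} (\<lambda>i. {t. inst k t y \<in> F i})"
  using assms by (auto simp: config_def intro!: line_free_subspace insens_subspace)

lemma gap_le_1: "0 \<le> \<delta> \<Longrightarrow> gap \<delta> j A F x \<le> 1"
  by (auto simp: gap_def of_bool_def)

text \<open>Finitely many steps of fixed size \<open>c\<close> lead from the trivial bound 1 down to
  \<epsilon>; taking the maximum with \<epsilon> keeps \<open>step\<close> applicable all the
  way.\<close>

lemma descend:
  fixes Q :: "real \<Rightarrow> bool"
  assumes mono: "\<And>e e'. e \<le> e' \<Longrightarrow> Q e \<Longrightarrow> Q e'"
    and start: "Q 1" and c: "c > 0"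
    and step: "\<And>e. \<epsilon> \<le> e \<Longrightarrow> Q e \<Longrightarrow> Q (e - c)"
  shows "Q \<epsilon>"
proof -
  have Qn: "Q (max \<epsilon> (1 - real n * c))" for n
  proof (induction n)
    case 0
    show ?case by (rule mono[OF _ start]) simp
  next
    case (Suc n)
    have "Q (max \<epsilon> (1 - real n * c) - c)" by (rule step[OF _ Suc]) simp
    then show ?case by (rule mono[rotated]) (use c in \<open>auto simp: algebra_simps max_def\<close>)
  qed
  obtain n where "(1 - \<epsilon>) / c < real n" using reals_Archimedean2 by blast
  then have "max \<epsilon> (1 - real n * c) = \<epsilon>" using c by (simp add: field_simps)
  then show ?thesis using Qn[of n] by simp
qed

lemma eventually_sequentially_shift:
  "(\<forall>\<^sub>F n in sequentially. P (m + n :: nat)) \<Longrightarrow> \<forall>\<^sub>F n in sequentially. P n"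
  using eventually_sequentially_seg[of P m] by (simp add: add.commute)

text \<open>Here the word is drawn uniformly; \<open>gap_pushforward\<close> passes to other product
  laws. For \<open>j = 0\<close> the condition says that \<delta> bounds the asymptotic density of
  line-free sets.\<close>

definition uniform_gap :: "nat \<Rightarrow> real \<Rightarrow> nat \<Rightarrow> bool" where
  "uniform_gap k \<delta> j \<longleftrightarrow> (\<forall>\<epsilon>>0. \<forall>\<^sub>F n in sequentially. \<forall>A F.
     config k j n A F \<longrightarrow> avg (gap \<delta> j A F) (words (Suc k) n) \<le> \<epsilon>)"

lemma uniform_gapE:
  assumes "uniform_gap k \<delta> j" "\<epsilon> > 0"
  obtains n where "\<And>A F. config k j n A F \<Longrightarrow> avg (gap \<delta> j A F) (words (Suc k) n) \<le> \<epsilon>"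
proof -
  have "\<exists>n. \<forall>A F. config k j n A F \<longrightarrow> avg (gap \<delta> j A F) (words (Suc k) n) \<le> \<epsilon>"
    using assms unfolding uniform_gap_def
    by (intro eventually_happens'[OF sequentially_bot]) auto
  then show ?thesis using that by blast
qed

text \<open>The penalised gap \<open>g\<close> charges \<open>\<epsilon>\<close> for every point of \<open>F j\<close>. If its average is nearly
  extremal, then all sections of \<open>F j\<close> over words of length \<open>m\<close> are dense, so a fixed subspace \<open>V\<close>
  satisfies \<open>V \<times> B \<subseteq> F j\<close> with \<open>B\<close> dense and insensitive. On \<open>V \<times> B\<close> the average of \<open>g\<close> is
  negative by the case \<open>j\<close>, and off it the extremal bound still applies because removing \<open>B\<close> from
  the sections of \<open>F j\<close> leaves an admissible configuration.\<close>

lemma uniform_gap_Suc: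
  assumes dhj: "dhj k 1" and k: "1 \<le> k" and j: "j < k" and \<delta>: "0 \<le> \<delta>"
    and gap: "uniform_gap k \<delta> j"
  shows "uniform_gap k \<delta> (Suc j)"
  unfolding uniform_gap_def
proof (intro allI impI)
  fix \<epsilon>' :: real assume \<epsilon>': "\<epsilon>' > 0"
  define \<epsilon> where "\<epsilon> = \<epsilon>' / 2"
  have \<epsilon>: "\<epsilon> > 0" using \<epsilon>' by (simp add: \<epsilon>_def)
  let ?W = "words (Suc k)"
  define g where "g A F x = gap \<delta> (Suc j) A F x - \<epsilon> * of_bool (x \<in> F j)" for A F x
  have g_le: "g A F x \<le> of_bool (x \<in> F j)" for A F x
    using \<delta> \<epsilon> by (auto simp: g_def gap_def of_bool_def)
  define Q where "Q e \<longleftrightarrow> (\<forall>\<^sub>F n in sequentially. \<forall>A F.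
     config k (Suc j) n A F \<longrightarrow> avg (g A F) (?W n) \<le> e)" for e
  \<comment> \<open>The bound is half the penalty in \<open>g\<close>, so on a subspace contained in
    \<open>F j\<close> the average of \<open>g\<close> is at most
    \<open>- (\<epsilon> / 2)\<close>.\<close>
  obtain d where d: "\<And>A F. config k j d A F \<Longrightarrow> avg (gap \<delta> j A F) (?W d) \<le> \<epsilon> / 2"
    using uniform_gapE[OF gap, of "\<epsilon> / 2"] \<epsilon> by auto
  obtain m \<theta>0 where \<theta>0: "\<theta>0 > 0" and m:
      "\<forall>(\<Omega> :: nat list set) E. finite \<Omega> \<longrightarrow> \<Omega> \<noteq> {} \<longrightarrow>
       \<epsilon> / 2 \<le> avg (\<lambda>z. avg (\<lambda>\<omega>. of_bool (\<omega> \<in> E z)) \<Omega>) (words k m) \<longrightarrow>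
       (\<exists>y\<in>tmpl k d m. \<theta>0 \<le> avg (\<lambda>\<omega>. of_bool (\<forall>t\<in>words k d. \<omega> \<in> E (inst k t y))) \<Omega>)"
    using dhj_prob[OF dhj_multidim[OF dhj k] k half_gt_zero[OF \<epsilon>]] by iprover
  define \<theta> where "\<theta> = min \<theta>0 1"
  have \<theta>: "0 < \<theta>" "\<theta> \<le> \<theta>0" "\<theta> \<le> 1" using \<theta>0 by (auto simp: \<theta>_def)
  \<comment> \<open>The loss \<open>(\<epsilon> / 2) * \<theta>\<close> incurred on
    \<open>V \<times> B\<close>, spread over all prefixes of length \<open>m\<close>.\<close>
  define c where "c = \<theta> * \<epsilon> / 2 / real (Suc k ^ m)"
  have cm: "c * real (Suc k ^ m) = \<theta> * \<epsilon> / 2" by (simp add: c_def del: of_nat_power)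
  have "Q \<epsilon>"
  proof (rule descend[where c = c])
    show "Q e'" if "e \<le> e'" "Q e" for e e'
      using that unfolding Q_def by (elim eventually_mono) (meson order_trans)
    show "Q 1" unfolding Q_def
    proof (intro always_eventually allI impI avg_le_const)
      show "g A F x \<le> 1" for A F x
        using g_le[of A F x] by (rule order_trans) auto
    qed auto
    show "c > 0" using \<theta> \<epsilon> by (simp add: c_def)
    fix e assume e: "\<epsilon> \<le> e" and Qe: "Q e"
    show "Q (e - c)" unfolding Q_def
    proof (rule eventually_sequentially_shift[of _ m], rule eventually_mono[OF Qe[unfolded Q_def]],
        intro allI impI)
      fix M A F
      assume bound: "\<forall>A F. config k (Suc j) M A F \<longrightarrow> avg (g A F) (?W M) \<le> e"
        and cfg: "config k (Suc j) (m + M) A F"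
      define s where "s z = avg (\<lambda>w. g A F (z @ w)) (?W M)" for z
      have avg_s: "avg (g A F) (?W (m + M)) = avg s (?W m)"
        unfolding s_def by (rule avg_words_append)
      have s_le: "s z \<le> e" if "z \<in> ?W m" for z
      proof -
        have "s z = avg (g {w. z @ w \<in> A} (\<lambda>i. {w. z @ w \<in> F i})) (?W M)"
          unfolding s_def by (rule avg_cong) (simp add: g_def gap_def)
        then show ?thesis using bound config_left[OF cfg that] j by auto
      qed
      show "avg (g A F) (?W (m + M)) \<le> e - c"
      proof (rule ccontr)
        assume "\<not> ?thesis"
        then have big: "e - c \<le> avg s (?W m)" by (simp add: avg_s)
        have s_ge: "\<epsilon> / 2 \<le> s z" if "z \<in> ?W m" for z
        proof -
          have "e - c * card (?W m) \<le> s z"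
            by (rule avg_bounded_above_pointwise[OF finite_words s_le big that])
          moreover have "c * card (?W m) \<le> \<epsilon> / 2"
            unfolding card_words cm using \<theta>(3) \<epsilon> by simp
          ultimately show ?thesis using e by linarith
        qed
        \<comment> \<open>Only prefixes without the letter \<open>k\<close> are considered, as
          \<open>dhj\<close> is available for \<open>k\<close> letters. Where \<open>g\<close> has a
          positive average, \<open>F j\<close> is dense because \<open>g\<close> is at most its
          indicator.\<close>
        have "\<epsilon> / 2 \<le> avg (\<lambda>z. avg (\<lambda>w. of_bool (w \<in> {w. z @ w \<in> F j})) (?W M)) (words k m)"
        proof (rule avg_ge_const)
          fix z assume "z \<in> words k m"
          then have "\<epsilon> / 2 \<le> s z" by (intro s_ge words_mono[of k "Suc k"]) auto
          also have "\<dots> \<le> avg (\<lambda>w. of_bool (w \<in> {w. z @ w \<in> F j})) (?W M)"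
            unfolding s_def using g_le by (intro avg_mono) auto
          finally show "\<epsilon> / 2 \<le> avg (\<lambda>w. of_bool (w \<in> {w. z @ w \<in> F j})) (?W M)" .
        qed (use k in auto)
        from m[rule_format, OF _ _ this] obtain y where y: "y \<in> tmpl k d m" and
          y\<theta>: "\<theta>0 \<le> avg (\<lambda>w. of_bool (\<forall>t\<in>words k d. w \<in> {w. inst k t y @ w \<in> F j})) (?W M)"
          by auto
        define B where "B = {w. \<forall>t\<in>words k d. inst k t y @ w \<in> F j}"
        have B\<theta>: "\<theta> \<le> avg (\<lambda>w. of_bool (w \<in> B)) (?W M)"
          using y\<theta> \<theta>(2) by (simp add: B_def)
        have Fj: "insens k j (m + M) (F j)" using cfg by (simp add: config_def)
        have B_ins: "insens k j M B"
        proof -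
          have "insens k j M {w. inst k t y @ w \<in> F j}" if "t \<in> words k d" for t
            using that y by (intro insens_left[OF Fj _ j] inst_words_tmpl words_mono[of k "Suc k"]) auto
          then show ?thesis unfolding insens_def B_def by blast
        qed
        \<comment> \<open>\<open>B\<close> only controls parameters over \<open>k\<close> letters;
          insensitivity of \<open>F j\<close> to exchanging \<open>k\<close> and \<open>j\<close>
          extends this to all parameters over \<open>Suc k\<close> letters.\<close>
        have B_full: "inst k t y @ w \<in> F j" if w: "w \<in> B" "w \<in> ?W M" and t: "t \<in> ?W d" for w t
        proof -
          have "inst k [j] t \<in> words k d" using t j by (intro inst_singleton_words) auto
          then have "inst k (inst k [j] t) y @ w \<in> F j" using w(1) by (simp add: B_def)
          then have "inst k [j] t \<in> {t. inst k t y \<in> {z. z @ w \<in> F j}}" by simp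
          then have "t \<in> {t. inst k t y \<in> {z. z @ w \<in> F j}}"
            using insens_subspace[OF insens_right[OF Fj w(2) j] y] t unfolding insens_def by blast
          then show ?thesis by simp
        qed
        define V where "V = (\<lambda>t. inst k t y) ` ?W d"
        have V: "V \<subseteq> ?W m" unfolding V_def using y inst_words_tmpl by fastforce
        have finV: "finite V" by (simp add: V_def)
        \<comment> \<open>\<open>g\<close> vanishes off \<open>F j\<close>, so deleting
          \<open>B\<close> from the section of \<open>F j\<close> multiplies \<open>g\<close> by the
          indicator of the complement of \<open>B\<close>.\<close>
        have out: "avg (\<lambda>w. g A F (z @ w) * of_bool (w \<notin> B)) (?W M) \<le> e" if z: "z \<in> V" for z
        proof -
          let ?A = "{w. z @ w \<in> A}"
          let ?F = "\<lambda>i. if i = j then {w. z @ w \<in> F i} - B else {w. z @ w \<in> F i}"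
          have c0: "config k (Suc j) M ?A (\<lambda>i. {w. z @ w \<in> F i})"
            using config_left[OF cfg] z V j by auto
          have "config k (Suc j) M ?A ?F"
            using c0 B_ins unfolding config_def insens_def by auto
          then have "avg (g ?A ?F) (?W M) \<le> e" using bound by blast
          moreover have "avg (g ?A ?F) (?W M) = avg (\<lambda>w. g A F (z @ w) * of_bool (w \<notin> B)) (?W M)"
            unfolding g_def gap_def by (rule avg_cong) (auto simp: less_Suc_eq of_bool_def)
          ultimately show ?thesis by simp
        qed
        \<comment> \<open>For \<open>w\<close> in \<open>B\<close> the whole subspace lies in
          \<open>F j\<close>: the condition for \<open>F j\<close> is vacuous and the penalty is
          constantly \<epsilon>, which leaves the gap for \<open>j\<close>.\<close>
        have inside: "(\<Sum>t\<in>?W d. g A F (inst k t y @ w) * of_bool (w \<in> B)) \<le> - (\<epsilon> / 2) * of_bool (w \<in> B)"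
          if w: "w \<in> ?W M" for w
        proof (cases "w \<in> B")
          case True
          let ?A = "{t. inst k t y \<in> {z. z @ w \<in> A}}"
          let ?F = "\<lambda>i. {t. inst k t y \<in> {z. z @ w \<in> F i}}"
          have "config k (Suc j) d ?A ?F"
            using config_subspace[OF config_right[OF cfg w] y] j by simp
          then have "config k j d ?A ?F" by (simp add: config_def)
          then have "avg (gap \<delta> j ?A ?F) (?W d) \<le> \<epsilon> / 2" by (rule d)
          then have "avg (\<lambda>t. gap \<delta> j ?A ?F t - \<epsilon>) (?W d) \<le> - (\<epsilon> / 2)"
            by (simp add: avg_diff avg_const)
          then have "(\<Sum>t\<in>?W d. gap \<delta> j ?A ?F t - \<epsilon>) \<le> - (\<epsilon> / 2) * real (Suc k ^ d)"
            unfolding avg_def card_words by (simp add: divide_le_eq del: of_nat_power of_nat_Suc)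
          also have "\<dots> \<le> - (\<epsilon> / 2) * 1"
          proof -
            have "1 \<le> real (Suc k ^ d)" using one_le_power[of "Suc k" d] by linarith
            then show ?thesis using \<epsilon> by (intro mult_left_mono_neg) auto
          qed
          also have "(\<Sum>t\<in>?W d. gap \<delta> j ?A ?F t - \<epsilon>) = (\<Sum>t\<in>?W d. g A F (inst k t y @ w))"
            using B_full[OF True w] unfolding g_def gap_def
            by (intro sum.cong) (auto simp: less_Suc_eq of_bool_def)
          finally show ?thesis using True by simp
        qed simp
        have "(\<Sum>z\<in>V. avg (\<lambda>w. g A F (z @ w) * of_bool (w \<in> B)) (?W M)) =
            avg (\<lambda>w. \<Sum>t\<in>?W d. g A F (inst k t y @ w) * of_bool (w \<in> B)) (?W M)"
          unfolding V_def avg_sum by (subst sum.reindex[OF inst_inj[OF y]]) simp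
        also have "\<dots> \<le> avg (\<lambda>w. - (\<epsilon> / 2) * of_bool (w \<in> B)) (?W M)"
          by (rule avg_mono) (rule inside)
        also have "\<dots> = - (\<epsilon> / 2) * avg (\<lambda>w. of_bool (w \<in> B)) (?W M)" by (rule avg_cmult)
        also have "\<dots> \<le> - (\<epsilon> / 2) * \<theta>" using B\<theta> \<epsilon> by (intro mult_left_mono_neg) auto
        finally have inV: "(\<Sum>z\<in>V. avg (\<lambda>w. g A F (z @ w) * of_bool (w \<in> B)) (?W M)) \<le> - (\<epsilon> / 2) * \<theta>" .
        have "s z = avg (\<lambda>w. g A F (z @ w) * of_bool (w \<notin> B)) (?W M) +
            avg (\<lambda>w. g A F (z @ w) * of_bool (w \<in> B)) (?W M)" for z
          unfolding s_def avg_add[symmetric] by (rule avg_cong) auto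
        then have "sum s V = (\<Sum>z\<in>V. avg (\<lambda>w. g A F (z @ w) * of_bool (w \<notin> B)) (?W M)) +
            (\<Sum>z\<in>V. avg (\<lambda>w. g A F (z @ w) * of_bool (w \<in> B)) (?W M))"
          by (simp add: sum.distrib)
        moreover have "(\<Sum>z\<in>V. avg (\<lambda>w. g A F (z @ w) * of_bool (w \<notin> B)) (?W M)) \<le> real (card V) * e"
          using sum_mono[of V _ "\<lambda>_. e", OF out] by simp
        ultimately have "sum s V \<le> real (card V) * e - (\<epsilon> / 2) * \<theta>"
          using inV by linarith
        moreover have "sum s (?W m - V) \<le> real (card (?W m - V)) * e"
          using sum_mono[of "?W m - V" s "\<lambda>_. e"] s_le by simp
        moreover have "sum s (?W m) = sum s V + sum s (?W m - V)"
          using sum.subset_diff[OF V finite_words, of s] by simp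
        moreover have "real (card (?W m)) = real (card V) + real (card (?W m - V))"
          using card_Diff_subset[OF finV V] card_mono[OF finite_words V] by simp
        ultimately have "sum s (?W m) \<le> real (card (?W m)) * e - (\<epsilon> / 2) * \<theta>"
          by (simp add: distrib_right del: card_words)
        then have "avg s (?W m) \<le> e - c"
          unfolding avg_def card_words c_def
          by (simp add: field_simps del: of_nat_power of_nat_Suc)
        then show False using \<open>\<not> avg (g A F) (?W (m + M)) \<le> e - c\<close> by (simp add: avg_s)
      qed
    qed
  qed
  then show "\<forall>\<^sub>F n in sequentially. \<forall>A F. config k (Suc j) n A F \<longrightarrow>
      avg (gap \<delta> (Suc j) A F) (?W n) \<le> \<epsilon>'"
    unfolding Q_def
  proof (elim eventually_mono, intro allI impI)
    fix n A F assume "\<forall>A F. config k (Suc j) n A F \<longrightarrow> avg (g A F) (?W n) \<le> \<epsilon>"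
      "config k (Suc j) n A F"
    then have "avg (g A F) (?W n) \<le> \<epsilon>" by blast
    moreover have "avg (gap \<delta> (Suc j) A F) (?W n) \<le> avg (\<lambda>x. g A F x + \<epsilon>) (?W n)"
      using \<epsilon> by (intro avg_mono) (simp add: g_def of_bool_def)
    ultimately show "avg (gap \<delta> (Suc j) A F) (?W n) \<le> \<epsilon>'"
      by (simp add: avg_add avg_const \<epsilon>_def)
  qed
qed

text \<open>A nearly extremal configuration for the image law of \<open>h\<close> has nearly extremal sections over
  every prefix; averaging these over uniform prefixes contradicts the uniform bound.\<close>

lemma gap_pushforward:
  assumes gap: "uniform_gap k \<delta> j" and j: "j \<le> k" and \<delta>: "0 \<le> \<delta>" and \<epsilon>: "\<epsilon> > 0"
    and h: "h ` {..<K} = {..<Suc k}"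
  shows "\<forall>\<^sub>F n in sequentially. \<forall>A F. config k j n A F \<longrightarrow>
     avg (\<lambda>r. gap \<delta> j A F (map h r)) (words K n) \<le> \<epsilon>"
proof -
  let ?W = "words (Suc k)"
  have K: "K > 0" using h by (cases K) auto
  have hW: "map h r \<in> ?W n" if "r \<in> words K n" for r n
    using that h by (auto simp: words_def)
  \<comment> \<open>Every prefix over \<open>Suc k\<close> letters has positive probability under
    the image law, so the bound for all sections reaches all of them.\<close>
  have hsurj: "\<exists>r\<in>words K n. map h r = z" if "z \<in> ?W n" for z n
  proof -
    have "z \<in> map h ` lists {..<K}"
      using that h by (simp add: words_def lists_image[symmetric] in_lists_conv_set subset_iff)
    then show ?thesis using that by (auto simp: words_def)
  qed
  obtain L where L: "\<And>A F. config k j L A F \<Longrightarrow> avg (gap \<delta> j A F) (?W L) \<le> \<epsilon> / 4"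
    using uniform_gapE[OF gap, of "\<epsilon> / 4"] \<epsilon> by auto
  define c where "c = \<epsilon> / 2 / real (K ^ L)"
  have cK: "c * real (K ^ L) = \<epsilon> / 2" using K by (simp add: c_def)
  show ?thesis
  proof (rule descend[where c = c and \<epsilon> = \<epsilon> and Q = "\<lambda>e. \<forall>\<^sub>F n in sequentially. \<forall>A F.
      config k j n A F \<longrightarrow> avg (\<lambda>r. gap \<delta> j A F (map h r)) (words K n) \<le> e"])
    show "\<forall>\<^sub>F n in sequentially. \<forall>A F.
        config k j n A F \<longrightarrow> avg (\<lambda>r. gap \<delta> j A F (map h r)) (words K n) \<le> e'"
      if "e \<le> e'" "\<forall>\<^sub>F n in sequentially. \<forall>A F.
        config k j n A F \<longrightarrow> avg (\<lambda>r. gap \<delta> j A F (map h r)) (words K n) \<le> e" for e e'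
      using that(2) by (elim eventually_mono) (use that(1) in \<open>meson order_trans\<close>)
    show "\<forall>\<^sub>F n in sequentially. \<forall>A F.
        config k j n A F \<longrightarrow> avg (\<lambda>r. gap \<delta> j A F (map h r)) (words K n) \<le> 1"
      using K \<delta> by (intro always_eventually allI impI avg_le_const gap_le_1) auto
    show "c > 0" using K \<epsilon> by (simp add: c_def)
    fix e assume e: "\<epsilon> \<le> e" and Qe: "\<forall>\<^sub>F n in sequentially. \<forall>A F.
        config k j n A F \<longrightarrow> avg (\<lambda>r. gap \<delta> j A F (map h r)) (words K n) \<le> e"
    show "\<forall>\<^sub>F n in sequentially. \<forall>A F.
        config k j n A F \<longrightarrow> avg (\<lambda>r. gap \<delta> j A F (map h r)) (words K n) \<le> e - c"
    proof (rule eventually_sequentially_shift[of _ L], rule eventually_mono[OF Qe], intro allI impI)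
      fix M A F
      assume bound: "\<forall>A F. config k j M A F \<longrightarrow>
          avg (\<lambda>r. gap \<delta> j A F (map h r)) (words K M) \<le> e"
        and cfg: "config k j (L + M) A F"
      define s where "s q = avg (\<lambda>r. gap \<delta> j A F (map h q @ map h r)) (words K M)" for q
      have s_le: "s q \<le> e" if "q \<in> words K L" for q
      proof -
        have "s q = avg (\<lambda>r. gap \<delta> j {w. map h q @ w \<in> A} (\<lambda>i. {w. map h q @ w \<in> F i}) (map h r))
            (words K M)"
          unfolding s_def by (rule avg_cong) (simp add: gap_def)
        then show ?thesis using bound config_left[OF cfg hW[OF that] j] by auto
      qed
      show "avg (\<lambda>r. gap \<delta> j A F (map h r)) (words K (L + M)) \<le> e - c"
      proof (rule ccontr)
        assume "\<not> ?thesis"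
        moreover have "avg (\<lambda>r. gap \<delta> j A F (map h r)) (words K (L + M)) = avg s (words K L)"
          unfolding s_def avg_words_append by simp
        ultimately have big: "e - c \<le> avg s (words K L)" by simp
        have s_ge: "\<epsilon> / 2 \<le> s q" if "q \<in> words K L" for q
          using avg_bounded_above_pointwise[OF finite_words s_le big that] cK e by simp
        \<comment> \<open>The prefix now gets the uniform law, while the tail keeps the image
          law.\<close>
        have "\<epsilon> / 2 \<le> avg (\<lambda>z. avg (\<lambda>r. gap \<delta> j A F (z @ map h r)) (words K M)) (?W L)"
        proof (rule avg_ge_const)
          fix z assume "z \<in> ?W L"
          then obtain q where "q \<in> words K L" "map h q = z" using hsurj by blast
          then show "\<epsilon> / 2 \<le> avg (\<lambda>r. gap \<delta> j A F (z @ map h r)) (words K M)"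
            using s_ge unfolding s_def by blast
        qed auto
        also have "\<dots> = avg (\<lambda>r. avg (\<lambda>z. gap \<delta> j A F (z @ map h r)) (?W L)) (words K M)"
          by (rule avg_swap)
        also have "\<dots> \<le> \<epsilon> / 4"
        proof (rule avg_le_const)
          fix r assume "r \<in> words K M"
          then show "avg (\<lambda>z. gap \<delta> j A F (z @ map h r)) (?W L) \<le> \<epsilon> / 4"
            using L[OF config_right[OF cfg hW j]] unfolding gap_def by simp
        qed (use K in auto)
        finally show False using \<epsilon> by simp
      qed
    qed
  qed
qed

section \<open>The density Hales--Jewett theorem\<close>

text \<open>The template here has no constant \<open>k\<close>: all occurrences of \<open>k\<close> in \<open>x\<close> become the variable.\<close>

lemma line_free_merge:
  assumes lf: "line_free (Suc k) n A" and x: "x \<in> words (Suc k) n" "k \<in> set x"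
    and A: "\<And>i. i < Suc k \<Longrightarrow> inst k [i] x \<in> A"
  shows False
proof -
  have "x \<in> tmpl k 1 n" using x by (simp add: tmpl_def)
  moreover have "[Suc k] \<in> tmpl (Suc k) 1 1" by (auto simp: tmpl_def words_def)
  ultimately have "inst k [Suc k] x \<in> tmpl (Suc k) 1 n" by (rule tmpl_inst) simp
  moreover have "inst (Suc k) t (inst k [Suc k] x) \<in> A" if "t \<in> words (Suc k) 1" for t
  proof -
    obtain i where i: "i < Suc k" "t = [i]" using \<open>t \<in> words (Suc k) 1\<close> unfolding words_one by auto
    have "inst (Suc k) t (inst k [Suc k] x) = inst k (inst (Suc k) t [Suc k]) x"
      using x by (intro inst_inst[of _ _ 1 n]) auto
    then show ?thesis using A[OF i(1)] i(2) by (simp add: inst_def[of "Suc k"])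
  qed
  ultimately show False using lf unfolding line_free_def by blast
qed

text \<open>Some letter \<open>k + b\<close> is sent to \<open>k\<close> by \<open>y\<close>, and a
  word \<open>r\<close> whose image misses \<open>k\<close> has to avoid that letter.\<close>

lemma avg_missing_letter:
  assumes "y \<in> tmpl k 1 m" "1 \<le> k"
  shows "avg (\<lambda>r. of_bool (k \<notin> set (inst k y r))) (words (k + m) L) \<le>
    ((real (k + m) - 1) / real (k + m)) ^ L"
proof -
  obtain b where b: "b < m" "y ! b = k"
    using assms(1) by (auto simp: tmpl_def words_def in_set_conv_nth)
  let ?S = "{xs. set xs \<subseteq> {..<k + m} - {k + b} \<and> length xs = L}"
  have "{r \<in> words (k + m) L. k \<notin> set (inst k y r)} \<subseteq> ?S"
  proof safe
    fix r v assume r: "r \<in> words (k + m) L" "k \<notin> set (inst k y r)"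
    then show "length r = L" "\<And>v. v \<in> set r \<Longrightarrow> v < k + m" by (auto simp: words_def)
    assume "k + b \<in> set r"
    then have "(if k + b < k then k + b else y ! (k + b - k)) \<in> set (inst k y r)"
      unfolding inst_def set_map by (rule imageI)
    then show False using b r(2) by simp
  qed
  then have "card {r \<in> words (k + m) L. k \<notin> set (inst k y r)} \<le> card ?S"
    by (intro card_mono finite_lists_length_eq) auto
  also have "card ?S = (k + m - 1) ^ L"
    using b by (subst card_lists_length_eq) auto
  finally have "real (card {r \<in> words (k + m) L. k \<notin> set (inst k y r)}) \<le> real ((k + m - 1) ^ L)"
    by (rule of_nat_mono)
  also have "\<dots> = (real (k + m) - 1) ^ L" using assms(2) by (simp add: of_nat_diff)
  finally show ?thesis
    by (simp add: avg_of_bool power_divide divide_right_mono)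
qed

text \<open>Splits the complement of an intersection into disjoint pieces according to the first
  condition that fails.\<close>

lemma sum_first_failure:
  "(\<Sum>i<k. of_bool ((\<forall>l<i. P l) \<and> \<not> P i)) = (of_bool (\<not> (\<forall>i<k. P i)) :: real)" for k :: nat
  by (induction k) (auto simp: less_Suc_eq of_bool_def)

text \<open>Prefixes \<open>inst k t r\<close> with \<open>r\<close> uniform over
  \<open>k + m\<close> letters give a product law for each \<open>t\<close>. A nearly extremal set
  has density almost \<delta> under all of them, and \<open>dhj_prob\<close> finds a
  \<open>y\<close> for which good prefixes have mass at least \<theta> on average. These almost miss
  the set, which is therefore too dense on their complement, against the gap bounds.\<close>

lemma density_drop:
  assumes dhj: "dhj k 1" and k: "1 \<le> k" and \<delta>: "\<delta> > 0"
    and upper: "\<And>\<eta>. \<eta> > 0 \<Longrightarrow> \<forall>\<^sub>F n in sequentially. \<forall>A. line_free (Suc k) n A \<longrightarrow>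
      avg (\<lambda>x. of_bool (x \<in> A)) (words (Suc k) n) \<le> \<delta> + \<eta>"
  shows "\<exists>c>0. \<forall>\<^sub>F n in sequentially. \<forall>A. line_free (Suc k) n A \<longrightarrow>
      avg (\<lambda>x. of_bool (x \<in> A)) (words (Suc k) n) \<le> \<delta> - c"
proof -
  let ?W = "words (Suc k)"
  have "uniform_gap k \<delta> 0"
    unfolding uniform_gap_def
  proof (intro allI impI)
    fix \<epsilon> :: real assume "\<epsilon> > 0"
    from upper[OF this] show "\<forall>\<^sub>F n in sequentially. \<forall>A F. config k 0 n A F \<longrightarrow>
        avg (gap \<delta> 0 A F) (?W n) \<le> \<epsilon>"
    proof (elim eventually_mono, intro allI impI)
      fix n A F
      assume *: "\<forall>A. line_free (Suc k) n A \<longrightarrow> avg (\<lambda>x. of_bool (x \<in> A)) (?W n) \<le> \<delta> + \<epsilon>"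
        "config k 0 n A F"
      have "avg (gap \<delta> 0 A F) (?W n) = avg (\<lambda>x. of_bool (x \<in> A) - \<delta>) (?W n)"
        by (rule avg_cong) (simp add: gap_def)
      also have "\<dots> = avg (\<lambda>x. of_bool (x \<in> A)) (?W n) - \<delta>"
        by (simp add: avg_diff avg_const)
      also have "\<dots> \<le> \<epsilon>" using * by (simp add: config_def algebra_simps)
      finally show "avg (gap \<delta> 0 A F) (?W n) \<le> \<epsilon>" .
    qed
  qed
  then have gaps: "j \<le> k \<Longrightarrow> uniform_gap k \<delta> j" for j
    by (induction j) (use dhj k \<delta> in \<open>auto intro!: uniform_gap_Suc\<close>)
  obtain m \<theta> where \<theta>: "\<theta> > 0" and m:
      "\<forall>(\<Omega> :: (nat list \<times> nat list) set) E. finite \<Omega> \<longrightarrow> \<Omega> \<noteq> {} \<longrightarrow>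
       \<delta> / 2 \<le> avg (\<lambda>z. avg (\<lambda>\<omega>. of_bool (\<omega> \<in> E z)) \<Omega>) (words k m) \<longrightarrow>
       (\<exists>y\<in>tmpl k 1 m. \<theta> \<le> avg (\<lambda>\<omega>. of_bool (\<forall>t\<in>words k 1. \<omega> \<in> E (inst k t y))) \<Omega>)"
    using dhj_prob[OF dhj k half_gt_zero[OF \<delta>]] by iprover
  let ?K = "k + m"
  \<comment> \<open>The complement of the good prefixes is cut into \<open>k\<close> pieces, which
    together may contribute \<open>\<delta> * \<theta> / 4\<close>.\<close>
  define \<kappa> where "\<kappa> = \<delta> * \<theta> / (4 * real k)"
  have \<kappa>: "\<kappa> > 0" "real k * \<kappa> = \<delta> * \<theta> / 4" using \<delta> \<theta> k by (auto simp: \<kappa>_def)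
  \<comment> \<open>The length \<open>L\<close> is fixed before \<open>y\<close> is known, so the
    bound is needed for all of the finitely many templates at once.\<close>
  have "\<forall>\<^sub>F L in sequentially. \<forall>y\<in>tmpl k 1 m. \<forall>A F. config k k L A F \<longrightarrow>
      avg (\<lambda>r. gap \<delta> k A F (inst k y r)) (words ?K L) \<le> \<kappa>"
  proof (rule eventually_ball_finite[OF finite_tmpl], rule ballI)
    fix y assume y: "y \<in> tmpl k 1 m"
    define h where "h a = (if a < k then a else y ! (a - k))" for a
    have "h ` {..<?K} = {..<Suc k}"
    proof (intro equalityI subsetI)
      fix v assume "v \<in> h ` {..<?K}"
      then obtain a where a: "a < ?K" "v = h a" by auto
      show "v \<in> {..<Suc k}"
        using a words_nth[OF tmpl_sub_words[OF y], of "a - k"] by (auto simp: h_def)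
    next
      fix v assume "v \<in> {..<Suc k}"
      moreover have "h v = v" "v \<in> {..<?K}" if "v < k" using that by (auto simp: h_def)
      moreover obtain b where "b < m" "y ! b = k"
        using y by (auto simp: tmpl_def words_def in_set_conv_nth)
      moreover from this have "h (k + b) = k" "k + b \<in> {..<?K}" by (auto simp: h_def)
      ultimately show "v \<in> h ` {..<?K}" by (metis image_eqI lessThan_iff less_Suc_eq)
    qed
    from gap_pushforward[OF gaps[OF order_refl] order_refl _ \<kappa>(1) this]
    show "\<forall>\<^sub>F L in sequentially. \<forall>A F. config k k L A F \<longrightarrow>
        avg (\<lambda>r. gap \<delta> k A F (inst k y r)) (words ?K L) \<le> \<kappa>"
      using \<delta> by (simp add: inst_def h_def[abs_def])
  qed
  moreover have "\<forall>\<^sub>F L in sequentially. ((real ?K - 1) / real ?K) ^ L < \<delta> * \<theta> / 4"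
  proof (rule order_tendstoD)
    show "(\<lambda>L. ((real ?K - 1) / real ?K) ^ L) \<longlonglongrightarrow> 0"
      using k by (intro LIMSEQ_realpow_zero) (auto simp: field_simps)
  qed (use \<delta> \<theta> in auto)
  ultimately have "\<forall>\<^sub>F L in sequentially. (\<forall>y\<in>tmpl k 1 m. \<forall>A F. config k k L A F \<longrightarrow>
      avg (\<lambda>r. gap \<delta> k A F (inst k y r)) (words ?K L) \<le> \<kappa>) \<and>
      ((real ?K - 1) / real ?K) ^ L < \<delta> * \<theta> / 4"
    by (rule eventually_conj)
  then obtain L where L: "\<forall>y\<in>tmpl k 1 m. \<forall>A F. config k k L A F \<longrightarrow>
      avg (\<lambda>r. gap \<delta> k A F (inst k y r)) (words ?K L) \<le> \<kappa>"
    and Lsmall: "((real ?K - 1) / real ?K) ^ L < \<delta> * \<theta> / 4"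
    using eventually_happens'[OF sequentially_bot] by blast
  define \<epsilon> where "\<epsilon> = min (\<delta> / 2) (\<delta> * \<theta> / 4)"
  have \<epsilon>: "\<epsilon> > 0" "\<epsilon> \<le> \<delta> / 2" "\<epsilon> \<le> \<delta> * \<theta> / 4" using \<delta> \<theta> by (auto simp: \<epsilon>_def)
  \<comment> \<open>Sections have density at most \<open>\<delta> + c\<close> and mean above
    \<open>\<delta> - c\<close>; this defect \<open>2 * c\<close> times the number of prefixes is
    \<epsilon>.\<close>
  define c where "c = \<epsilon> / (2 * real (Suc k ^ L))"
  have c: "c > 0" "(2 * c) * real (Suc k ^ L) = \<epsilon>"
    using \<epsilon>(1) by (auto simp: c_def simp del: of_nat_power)
  have "\<forall>\<^sub>F n in sequentially. \<forall>A. line_free (Suc k) (L + n) A \<longrightarrow>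
      avg (\<lambda>x. of_bool (x \<in> A)) (?W (L + n)) \<le> \<delta> - c"
    using upper[OF c(1)]
  proof (elim eventually_mono, intro allI impI)
    fix M A
    assume bound: "\<forall>A. line_free (Suc k) M A \<longrightarrow> avg (\<lambda>x. of_bool (x \<in> A)) (?W M) \<le> \<delta> + c"
      and lf: "line_free (Suc k) (L + M) A"
    define s where "s z = avg (\<lambda>w. of_bool (z @ w \<in> A)) (?W M)" for z
    have s_le: "s z \<le> \<delta> + c" if "z \<in> ?W L" for z
      using bound[rule_format, OF line_free_left[OF lf that]] by (simp add: s_def)
    have avg_s: "avg (\<lambda>x. of_bool (x \<in> A)) (?W (L + M)) = avg s (?W L)"
      unfolding s_def avg_words_append by simp
    show "avg (\<lambda>x. of_bool (x \<in> A)) (?W (L + M)) \<le> \<delta> - c"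
    proof (rule ccontr)
      assume "\<not> ?thesis"
      then have big: "(\<delta> + c) - 2 * c \<le> avg s (?W L)" by (simp add: avg_s)
      have s_ge: "\<delta> - \<epsilon> \<le> s z" if "z \<in> ?W L" for z
      proof -
        have "(\<delta> + c) - 2 * c * real (card (?W L)) \<le> s z"
          by (rule avg_bounded_above_pointwise[OF finite_words s_le big that])
        then show ?thesis unfolding card_words c(2) using c(1) by linarith
      qed
      have instW: "inst k t r \<in> ?W L" if "t \<in> ?W m" "r \<in> words ?K L" for t r
        using that by (intro inst_words[of r k m L t]) auto
      define E where "E t = {(r, w). inst k t r @ w \<in> A}" for t
      have Kne: "words ?K L \<noteq> {}" using k by simp
      have dens: "\<delta> - \<epsilon> \<le> avg (\<lambda>r. avg (\<lambda>w. of_bool (inst k t r @ w \<in> A)) (?W M)) (words ?K L)"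
        if "t \<in> ?W m" for t
      proof (rule avg_ge_const[OF finite_words Kne])
        fix r assume "r \<in> words ?K L"
        then show "\<delta> - \<epsilon> \<le> avg (\<lambda>w. of_bool (inst k t r @ w \<in> A)) (?W M)"
          using s_ge[OF instW[OF that]] by (simp add: s_def)
      qed
      have "\<delta> / 2 \<le> avg (\<lambda>t. avg (\<lambda>\<omega>. of_bool (\<omega> \<in> E t)) (words ?K L \<times> ?W M)) (words k m)"
      proof (rule avg_ge_const)
        fix t assume "t \<in> words k m"
        then have "t \<in> ?W m" by (rule words_mono[rotated]) simp
        from dens[OF this] \<epsilon>(2)
        show "\<delta> / 2 \<le> avg (\<lambda>\<omega>. of_bool (\<omega> \<in> E t)) (words ?K L \<times> ?W M)"
          unfolding avg_times E_def by simp
      qed (use k in auto)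
      from m[rule_format, OF _ _ this] Kne obtain y where y: "y \<in> tmpl k 1 m"
        and y\<theta>: "\<theta> \<le> avg (\<lambda>\<omega>. of_bool (\<forall>t\<in>words k 1. \<omega> \<in> E (inst k t y))) (words ?K L \<times> ?W M)"
        by (auto simp del: card_words)
      have yW: "y \<in> ?W m" using tmpl_sub_words[OF y] by simp
      \<comment> \<open>\<open>C w i\<close> collects the prefixes that land in the section of
        \<open>A\<close> once \<open>k\<close> is replaced by \<open>i\<close>; it is insensitive by
        construction, and \<open>good\<close> is the intersection over \<open>i < k\<close>.\<close>
      define C where "C w i = {x. inst k [i] x @ w \<in> A}" for w i
      define good where "good r w \<longleftrightarrow> (\<forall>i<k. inst k y r \<in> C w i)" for r w
      have E_good: "(\<forall>t\<in>words k 1. (r, w) \<in> E (inst k t y)) \<longleftrightarrow> good r w" if "r \<in> words ?K L" for r w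
      proof -
        have "inst k (inst k [i] y) r = inst k [i] (inst k y r)" for i
          using that yW by (intro inst_inst[of _ _ m L, symmetric]) (auto simp: words_def)
        then show ?thesis unfolding words_one by (auto simp: E_def good_def C_def)
      qed
      have avg_good: "\<theta> \<le> avg (\<lambda>r. avg (\<lambda>w. of_bool (good r w)) (?W M)) (words ?K L)"
      proof -
        have "avg (\<lambda>\<omega>. of_bool (\<forall>t\<in>words k 1. \<omega> \<in> E (inst k t y))) (words ?K L \<times> ?W M) =
            avg (\<lambda>r. avg (\<lambda>w. of_bool (good r w)) (?W M)) (words ?K L)"
          unfolding avg_times by (intro avg_cong) (simp only: E_good)
        then show ?thesis using y\<theta> by simp
      qed
      \<comment> \<open>The excess of \<open>A\<close> over density \<delta> on the complement of
        the good prefixes.\<close>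
      define f where "f r w = (of_bool (inst k y r @ w \<in> A) - \<delta>) * of_bool (\<not> good r w)" for r w
      have f_le: "avg (\<lambda>r. f r w) (words ?K L) \<le> \<delta> * \<theta> / 4" if w: "w \<in> ?W M" for w
      proof -
        \<comment> \<open>The piece on which condition \<open>i\<close> is the first to fail; later
          conditions are left free by \<open>UNIV\<close>, and complements of insensitive sets are
          insensitive.\<close>
        define F where "F i l = (if l < i then C w l else if l = i then - C w l else UNIV)" for i l
        let ?A = "{x. x @ w \<in> A}"
        have C_ins: "insens k i L (C w i)" if "i < k" for i
          using that inst_singleton_twice unfolding insens_def C_def by auto
        have cfg: "config k k L ?A (F i)" for i
          unfolding config_def F_def
          using line_free_right[OF lf w] C_ins by (auto simp: insens_def)
        have gap_F: "gap \<delta> k ?A (F i) x =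
            (of_bool (x @ w \<in> A) - \<delta>) * of_bool ((\<forall>l<i. x \<in> C w l) \<and> x \<notin> C w i)" if "i < k" for i x
        proof -
          have "(\<forall>l<k. x \<in> F i l) \<longleftrightarrow> (\<forall>l<i. x \<in> C w l) \<and> x \<notin> C w i"
            using that unfolding F_def by (auto split: if_splits)
          then show ?thesis by (simp add: gap_def of_bool_conj algebra_simps)
        qed
        have "(\<Sum>i<k. gap \<delta> k ?A (F i) (inst k y r)) = f r w" for r
          by (simp add: gap_F f_def good_def sum_first_failure flip: sum_distrib_left)
        then have "avg (\<lambda>r. f r w) (words ?K L) =
            (\<Sum>i<k. avg (\<lambda>r. gap \<delta> k ?A (F i) (inst k y r)) (words ?K L))"
          by (simp flip: avg_sum)
        also have "\<dots> \<le> (\<Sum>i<k. \<kappa>)" using L y cfg by (intro sum_mono) blast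
        finally show ?thesis using \<kappa>(2) by simp
      qed
      \<comment> \<open>A good prefix in \<open>A\<close> that contains \<open>k\<close> would
        complete a line: goodness supplies the letters below \<open>k\<close>, and the prefix itself
        the letter \<open>k\<close>.\<close>
      have f_ge: "of_bool (inst k y r @ w \<in> A) - of_bool (k \<notin> set (inst k y r)) - \<delta> + \<delta> * of_bool (good r w)
          \<le> f r w" if r: "r \<in> words ?K L" and w: "w \<in> ?W M" for r w
      proof (cases "good r w \<and> inst k y r @ w \<in> A")
        case True
        have "k \<notin> set (inst k y r)"
        proof
          assume "k \<in> set (inst k y r)"
          moreover have "inst k [i] (inst k y r) \<in> {x. x @ w \<in> A}" if "i < Suc k" for i
            using True that inst_same[OF instW[OF yW r]] unfolding good_def C_def
            by (auto simp: less_Suc_eq)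
          ultimately show False
            using line_free_merge[OF line_free_right[OF lf w] instW[OF yW r]] by blast
        qed
        then show ?thesis using True by (simp add: f_def)
      next
        case False
        then show ?thesis by (auto simp: f_def of_bool_def)
      qed
      let ?avg = "\<lambda>f. avg (\<lambda>r. avg (\<lambda>w. f r w) (?W M)) (words ?K L)"
      have "?avg (\<lambda>r w. of_bool (inst k y r @ w \<in> A) - of_bool (k \<notin> set (inst k y r)) - \<delta> +
          \<delta> * of_bool (good r w)) \<le> ?avg f"
        by (intro avg_mono f_ge)
      also have "\<dots> = avg (\<lambda>w. avg (\<lambda>r. f r w) (words ?K L)) (?W M)" by (rule avg_swap)
      also have "\<dots> \<le> \<delta> * \<theta> / 4" by (rule avg_le_const) (use f_le in auto)
      finally have "?avg (\<lambda>r w. of_bool (inst k y r @ w \<in> A)) -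
          avg (\<lambda>r. of_bool (k \<notin> set (inst k y r))) (words ?K L) - \<delta> +
          \<delta> * ?avg (\<lambda>r w. of_bool (good r w)) \<le> \<delta> * \<theta> / 4"
        using Kne by (simp add: avg_add avg_diff avg_cmult avg_const)
      moreover have "\<delta> - \<epsilon> \<le> ?avg (\<lambda>r w. of_bool (inst k y r @ w \<in> A))" by (rule dens[OF yW])
      moreover have "avg (\<lambda>r. of_bool (k \<notin> set (inst k y r))) (words ?K L) \<le> \<delta> * \<theta> / 4"
        using avg_missing_letter[OF y k, of L] Lsmall by linarith
      moreover have "\<delta> * \<theta> \<le> \<delta> * ?avg (\<lambda>r w. of_bool (good r w))"
        using avg_good \<delta> by (intro mult_left_mono) auto
      moreover have "\<delta> * \<theta> > 0" using \<delta> \<theta> by simp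
      \<comment> \<open>Good prefixes contribute \<open>\<delta> * \<theta>\<close>, whereas the
        density defect, the missing letter and the pieces cost at most a quarter of it each.\<close>
      ultimately show False using \<epsilon>(3) by linarith
    qed
  qed
  then show ?thesis
    by (intro exI[of _ c] conjI c(1)) (rule eventually_sequentially_shift[of _ L])
qed

text \<open>\<open>Inf X\<close> is the critical density. By definition of the infimum every
  slightly larger bound is valid, so \<open>density_drop\<close> would contradict minimality if it
  were positive.\<close>

lemma dhj_Suc:
  assumes "dhj k 1" "1 \<le> k"
  shows "dhj (Suc k) 1"
proof -
  let ?P = "\<lambda>\<delta>. \<forall>\<^sub>F n in sequentially. \<forall>A. line_free (Suc k) n A \<longrightarrow>
      avg (\<lambda>x. of_bool (x \<in> A)) (words (Suc k) n) \<le> \<delta>"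
  define X where "X = {\<delta>::real. 0 \<le> \<delta> \<and> ?P \<delta>}"
  have mono: "?P \<delta>'" if "?P \<delta>" "\<delta> \<le> \<delta>'" for \<delta> \<delta>'
    using that(1) by (elim eventually_mono) (use that(2) in \<open>meson order_trans\<close>)
  have "?P 1" by (intro always_eventually allI impI avg_le_const) auto
  then have ne: "X \<noteq> {}" unfolding X_def by (intro notI) (auto dest: equalityD1)
  have bdd: "bdd_below X" by (rule bdd_belowI[of _ 0]) (simp add: X_def)
  have "0 \<le> Inf X" using ne by (rule cInf_greatest) (simp add: X_def)
  have near: "?P (Inf X + \<eta>)" if "\<eta> > 0" for \<eta>
  proof -
    have "Inf X < Inf X + \<eta>" using that by simp
    then obtain x where x: "x \<in> X" "x < Inf X + \<eta>" using cInf_lessD[OF ne] by blast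
    from x(1) have "?P x" by (simp add: X_def)
    then show ?thesis by (rule mono) (use x(2) in simp)
  qed
  have zero: "Inf X = 0"
  proof (rule ccontr)
    assume "Inf X \<noteq> 0"
    then have pos: "Inf X > 0" using \<open>0 \<le> Inf X\<close> by simp
    obtain c where c: "c > 0" "?P (Inf X - c)"
      using density_drop[OF assms pos near] by blast
    \<comment> \<open>Truncation at 0 keeps the new bound inside \<open>X\<close>; it is still below
      \<open>Inf X\<close>.\<close>
    have "?P (max 0 (Inf X - c))" by (rule mono[OF c(2)]) simp
    then have "max 0 (Inf X - c) \<in> X" by (simp add: X_def)
    then have "Inf X \<le> max 0 (Inf X - c)" using bdd by (rule cInf_lower)
    then show False using pos c(1) by (simp add: max_def split: if_splits)
  qed
  show ?thesis unfolding dhj_def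
  proof (intro allI impI)
    fix \<delta> :: real assume \<delta>: "\<delta> > 0"
    have "?P (\<delta> / 2)" using near[of "\<delta> / 2"] \<delta> zero by simp
    then obtain n where n: "\<forall>A. line_free (Suc k) n A \<longrightarrow>
        avg (\<lambda>x. of_bool (x \<in> A)) (words (Suc k) n) \<le> \<delta> / 2"
      using eventually_happens'[OF sequentially_bot] by blast
    show "\<exists>m. \<forall>A. \<delta> \<le> avg (\<lambda>x. of_bool (x \<in> A)) (words (Suc k) m) \<longrightarrow>
        (\<exists>y\<in>tmpl (Suc k) 1 m. \<forall>t\<in>words (Suc k) 1. inst (Suc k) t y \<in> A)"
    proof (intro exI[of _ n] allI impI)
      fix A assume "\<delta> \<le> avg (\<lambda>x. of_bool (x \<in> A)) (words (Suc k) n)"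
      then have "\<not> line_free (Suc k) n A" using n[rule_format, of A] \<delta> by linarith
      then show "\<exists>y\<in>tmpl (Suc k) 1 n. \<forall>t\<in>words (Suc k) 1. inst (Suc k) t y \<in> A"
        unfolding line_free_def by blast
    qed
  qed
qed

theorem density_hales_jewett:
  assumes "1 \<le> k"
  shows "dhj k 1"
  using assms
proof (induction k rule: nat_induct_at_least)
  case base
  show ?case unfolding dhj_def
  proof (intro allI impI exI[of _ 1])
    fix \<delta> :: real and A
    assume \<delta>: "\<delta> > 0" "\<delta> \<le> avg (\<lambda>x. of_bool (x \<in> A)) (words 1 1)"
    have one: "words 1 1 = {[0]}" unfolding words_one by auto
    have "[0] \<in> A"
    proof (rule ccontr)
      assume "[0] \<notin> A"
      then show False using \<delta> unfolding one by (simp add: avg_def)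
    qed
    moreover have "[1] \<in> tmpl 1 1 1" by (auto simp: tmpl_def words_def)
    ultimately show "\<exists>y\<in>tmpl 1 1 1. \<forall>t\<in>words 1 1. inst 1 t y \<in> A"
      unfolding one by (intro bexI[of _ "[1]"]) (auto simp: inst_def)
  qed
qed (rule dhj_Suc)

section \<open>Homothetic copies of polynomial sets\<close>

lemma avg_translate:
  fixes G :: "'b::ab_group_add set"
  assumes add: "\<And>x y. x \<in> G \<Longrightarrow> y \<in> G \<Longrightarrow> x + y \<in> G" and minus: "\<And>x. x \<in> G \<Longrightarrow> - x \<in> G"
    and u: "u \<in> G"
  shows "avg (\<lambda>x. f (x + u)) G = avg f G"
proof -
  have "bij_betw (\<lambda>x. x + u) G G"
    by (rule bij_betwI[where g = "\<lambda>x. x + - u"])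
      (auto intro!: add minus u simp del: add_uminus_conv_diff)
  from sum.reindex_bij_betw[OF this, of f] show ?thesis by (simp add: avg_def)
qed

text \<open>Applied to the variable positions of a line, this makes the common difference
  uniform.\<close>

lemma avg_sum_coordinates:
  fixes G :: "'b::ab_group_add set" and I :: "'i set"
  assumes add: "\<And>x y. x \<in> G \<Longrightarrow> y \<in> G \<Longrightarrow> x + y \<in> G" and minus: "\<And>x. x \<in> G \<Longrightarrow> - x \<in> G"
    and zero: "0 \<in> G" and fin: "finite G" "finite I" and J: "J \<subseteq> I" "J \<noteq> {}"
  shows "avg (\<lambda>g. f (\<Sum>j\<in>J. g j)) (PiE I (\<lambda>_. G)) = avg f G"
proof -
  let ?S = "PiE I (\<lambda>_. G)"
  obtain i where i: "i \<in> J" using J by blast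
  have finJ: "finite J" using fin(2) J(1) by (rule rev_finite_subset)
  have sumG: "(\<Sum>j\<in>J. g j) \<in> G" if "g \<in> ?S" for g
  proof -
    have "(\<Sum>j\<in>J'. g j) \<in> G" if "finite J'" "J' \<subseteq> J" for J'
      using that
    proof (induction J' rule: finite_induct)
      case (insert x J')
      then have "g x \<in> G" using \<open>g \<in> ?S\<close> J(1) by auto
      then show ?case using insert add by simp
    qed (simp add: zero)
    then show ?thesis using finJ by blast
  qed
  \<comment> \<open>The coordinate \<open>i\<close> absorbs any translation, so the law of the sum is translation invariant.\<close>
  have shift: "avg (\<lambda>g. f (\<Sum>j\<in>J. g j)) ?S = avg (\<lambda>g. f (a + (\<Sum>j\<in>J. g j))) ?S" if a: "a \<in> G" for a
  proof -
    let ?h = "\<lambda>a g. g(i := g i + a)"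
    have mem: "?h b g \<in> ?S" if "g \<in> ?S" "b \<in> G" for b g
    proof (rule PiE_I)
      show "?h b g x \<in> G" if "x \<in> I" for x
        using that \<open>g \<in> ?S\<close> \<open>b \<in> G\<close> add by auto
      show "?h b g x = undefined" if "x \<notin> I" for x
      proof -
        have "x \<noteq> i" using \<open>x \<notin> I\<close> i J(1) by blast
        then show ?thesis using PiE_arb[OF \<open>g \<in> ?S\<close> \<open>x \<notin> I\<close>] by simp
      qed
    qed
    have bij: "bij_betw (?h a) ?S ?S"
    proof (rule bij_betwI)
      show "?h a \<in> ?S \<rightarrow> ?S" "?h (- a) \<in> ?S \<rightarrow> ?S" using mem a minus by blast+
    qed auto
    have "(\<Sum>j\<in>J. ?h a g j) = a + (\<Sum>j\<in>J. g j)" for g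
      using finJ i by (simp add: sum.remove[of J i] add_ac)
    then show ?thesis
      using sum.reindex_bij_betw[OF bij, of "\<lambda>g. f (\<Sum>j\<in>J. g j)"] by (simp add: avg_def)
  qed
  have "avg (\<lambda>g. f (\<Sum>j\<in>J. g j)) ?S = avg (\<lambda>a. avg (\<lambda>g. f (\<Sum>j\<in>J. g j)) ?S) G"
    using fin(1) zero by (subst avg_const) auto
  also have "\<dots> = avg (\<lambda>a. avg (\<lambda>g. f (a + (\<Sum>j\<in>J. g j))) ?S) G"
    using shift by (rule avg_cong)
  also have "\<dots> = avg (\<lambda>g. avg (\<lambda>a. f (a + (\<Sum>j\<in>J. g j))) G) ?S" by (rule avg_swap)
  also have "\<dots> = avg (\<lambda>_. avg f G) ?S"
    by (intro avg_cong avg_translate add minus sumG)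
  also have "\<dots> = avg f G"
    using fin zero by (intro avg_const finite_PiE) (auto simp: PiE_eq_empty_iff)
  finally show ?thesis .
qed

lemma Gdeg_zero: "0 \<in> Gdeg N"
  by (simp add: Gdeg_def)

lemma Gdeg_add: "p \<in> Gdeg N \<Longrightarrow> q \<in> Gdeg N \<Longrightarrow> p + q \<in> Gdeg N"
  using degree_add_less[of p N q] by (auto simp: Gdeg_def)

lemma Gdeg_minus: "p \<in> Gdeg N \<Longrightarrow> - p \<in> Gdeg N" for p :: "'a::ab_group_add poly"
  by (auto simp: Gdeg_def)

lemma finite_Gdeg: "finite (Gdeg N :: 'a::{finite,zero} poly set)"
proof -
  have "Gdeg N \<subseteq> Poly ` {xs. set xs \<subseteq> (UNIV :: 'a set) \<and> length xs \<le> N}"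
  proof
    fix p :: "'a poly" assume "p \<in> Gdeg N"
    then have "length (coeffs p) \<le> N" by (cases "p = 0") (auto simp: Gdeg_def length_coeffs)
    then show "p \<in> Poly ` {xs. set xs \<subseteq> UNIV \<and> length xs \<le> N}"
      by (intro image_eqI[of _ _ "coeffs p"]) auto
  qed
  then show ?thesis
    by (rule finite_subset) (intro finite_imageI finite_lists_length_le finite)
qed

lemma mod_in_Gdeg:
  "degree m = N \<Longrightarrow> 1 \<le> N \<Longrightarrow> p mod m \<in> Gdeg N" for p :: "'a::field poly"
  using degree_mod_less[of m p] by (force simp: Gdeg_def)

text \<open>Letters enumerate \<open>F\<close>, and a random affine map sends words to residues. As
  \<open>f\<close> is uniform, every word hits \<open>A\<close> with probability the density of
  \<open>A\<close>, so \<open>dhj_prob\<close> applies, with a \<theta> chosen before the modulus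
  and \<open>N\<close>.\<close>

lemma homothetic_copies:
  fixes F :: "'a::{finite,field} poly set" and \<delta> :: real
  assumes F: "finite F" "F \<noteq> {}" and \<delta>: "\<delta> > 0"
  shows "\<exists>\<theta>>0. \<forall>(M::'a poly) A N. 1 \<le> N \<longrightarrow> degree M = N \<longrightarrow>
    \<delta> \<le> avg (\<lambda>x. of_bool (x \<in> A)) (Gdeg N) \<longrightarrow>
    \<theta> \<le> avg (\<lambda>(f, g). of_bool (\<forall>P\<in>F. f + (P * g) mod M \<in> A)) (Gdeg N \<times> Gdeg N)"
proof -
  define K where "K = card F"
  have K: "1 \<le> K" using F by (simp add: K_def Suc_le_eq card_gt_0_iff)
  obtain e where e: "bij_betw e {..<K} F"
    using ex_bij_betw_nat_finite[OF F(1)] by (auto simp: K_def lessThan_atLeast0)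
  obtain m \<theta> where \<theta>: "\<theta> > 0" and m:
      "\<forall>(\<Omega> :: ('a poly \<times> (nat \<Rightarrow> 'a poly)) set) E. finite \<Omega> \<longrightarrow> \<Omega> \<noteq> {} \<longrightarrow>
       \<delta> \<le> avg (\<lambda>z. avg (\<lambda>\<omega>. of_bool (\<omega> \<in> E z)) \<Omega>) (words K m) \<longrightarrow>
       (\<exists>y\<in>tmpl K 1 m. \<theta> \<le> avg (\<lambda>\<omega>. of_bool (\<forall>t\<in>words K 1. \<omega> \<in> E (inst K t y))) \<Omega>)"
    using dhj_prob[OF density_hales_jewett[OF K] K \<delta>] by iprover
  show ?thesis
  proof (intro exI[of _ \<theta>] conjI allI impI)
    show "\<theta> > 0" by (rule \<theta>)
    fix M :: "'a poly" and A :: "'a poly set" and N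
    assume N: "1 \<le> N" "degree M = N" and A: "\<delta> \<le> avg (\<lambda>x. of_bool (x \<in> A)) (Gdeg N)"
    let ?G = "Gdeg N :: 'a poly set"
    let ?S = "PiE {..<m} (\<lambda>_. ?G)"
    have modG: "p mod M \<in> ?G" for p using mod_in_Gdeg N by blast
    have finS: "finite ?S" by (intro finite_PiE finite_Gdeg) auto
    have neS: "?S \<noteq> {}" using Gdeg_zero by (auto simp: PiE_eq_empty_iff)
    have neG: "?G \<noteq> {}" using Gdeg_zero by auto
    define E where "E z = {(f, g). f + (\<Sum>j<m. e (z ! j) * g j) mod M \<in> A}" for z
    have "\<delta> \<le> avg (\<lambda>z. avg (\<lambda>\<omega>. of_bool (\<omega> \<in> E z)) (?G \<times> ?S)) (words K m)"
    proof (rule avg_ge_const)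
      fix z
      have "\<delta> \<le> avg (\<lambda>g. avg (\<lambda>f. of_bool (f + (\<Sum>j<m. e (z ! j) * g j) mod M \<in> A)) ?G) ?S"
      proof (rule avg_ge_const[OF finS neS])
        fix g
        show "\<delta> \<le> avg (\<lambda>f. of_bool (f + (\<Sum>j<m. e (z ! j) * g j) mod M \<in> A)) ?G"
          using A avg_translate[of ?G _ "\<lambda>x. of_bool (x \<in> A)", OF Gdeg_add Gdeg_minus modG] by simp
      qed
      also have "\<dots> = avg (\<lambda>\<omega>. of_bool (\<omega> \<in> E z)) (?G \<times> ?S)"
        unfolding avg_times E_def by (subst avg_swap) simp
      finally show "\<delta> \<le> avg (\<lambda>\<omega>. of_bool (\<omega> \<in> E z)) (?G \<times> ?S)" .
    qed (use K in auto)
    from m[rule_format, OF _ _ this] finite_Gdeg finS neG neS obtain y where y: "y \<in> tmpl K 1 m"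
      and y\<theta>: "\<theta> \<le> avg (\<lambda>\<omega>. of_bool (\<forall>t\<in>words K 1. \<omega> \<in> E (inst K t y))) (?G \<times> ?S)"
      by auto
    have ly: "length y = m" using y by (auto simp: tmpl_def words_def)
    \<comment> \<open>\<open>J\<close> holds the variable positions of the line and
      \<open>J'\<close> the constant ones. The constants contribute the shift \<open>a g\<close>,
      the variables the difference \<open>\<Sum>j\<in>J. g j\<close>.\<close>
    define J where "J = {j. j < m \<and> \<not> y ! j < K}"
    define J' where "J' = {j. j < m \<and> y ! j < K}"
    have J: "J \<subseteq> {..<m}" "J \<noteq> {}" "J' \<inter> J = {}" "{..<m} = J' \<union> J"
      using y by (auto simp: J_def J'_def tmpl_def words_def in_set_conv_nth)
    have yK: "y ! j = K" if "j \<in> J" for j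
      using that words_nth[OF tmpl_sub_words[OF y], of j] by (auto simp: J_def)
    define a where "a g = (\<Sum>j\<in>J'. e (y ! j) * g j) mod M" for g
    define Q where "Q f g \<longleftrightarrow> (\<forall>P\<in>F. f + (P * g) mod M \<in> A)" for f g
    have pt: "f + (\<Sum>j<m. e (inst K [i] y ! j) * g j) mod M = (f + a g) + (e i * (\<Sum>j\<in>J. g j)) mod M"
      for f g i
    proof -
      have "(\<Sum>j<m. e (inst K [i] y ! j) * g j) =
          (\<Sum>j\<in>J'. e (inst K [i] y ! j) * g j) + (\<Sum>j\<in>J. e (inst K [i] y ! j) * g j)"
        unfolding J(4) using J(3) by (intro sum.union_disjoint) (auto simp: J_def J'_def)
      also have "(\<Sum>j\<in>J'. e (inst K [i] y ! j) * g j) = (\<Sum>j\<in>J'. e (y ! j) * g j)"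
        by (intro sum.cong) (auto simp: inst_def J'_def ly)
      also have "(\<Sum>j\<in>J. e (inst K [i] y ! j) * g j) = e i * (\<Sum>j\<in>J. g j)"
        unfolding sum_distrib_left
      proof (rule sum.cong[OF refl])
        fix j assume "j \<in> J"
        then have "j < length y" "y ! j = K" using J(1) yK by (auto simp: ly)
        then show "e (inst K [i] y ! j) * g j = e i * g j" by (simp add: inst_def)
      qed
      finally show ?thesis by (simp add: a_def poly_mod_add_left add.assoc)
    qed
    have good: "(\<forall>t\<in>words K 1. (f, g) \<in> E (inst K t y)) \<longleftrightarrow> Q (f + a g) (\<Sum>j\<in>J. g j)" for f g
    proof -
      have "(\<forall>t\<in>words K 1. (f, g) \<in> E (inst K t y)) \<longleftrightarrow>
          (\<forall>i<K. (f + a g) + (e i * (\<Sum>j\<in>J. g j)) mod M \<in> A)"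
        unfolding words_one E_def by (auto simp: pt)
      also have "\<dots> \<longleftrightarrow> Q (f + a g) (\<Sum>j\<in>J. g j)"
        unfolding Q_def bij_betw_imp_surj_on[OF e, symmetric] by auto
      finally show ?thesis .
    qed
    note y\<theta>
    also have "avg (\<lambda>\<omega>. of_bool (\<forall>t\<in>words K 1. \<omega> \<in> E (inst K t y))) (?G \<times> ?S) =
        avg (\<lambda>g. avg (\<lambda>f. of_bool (Q (f + a g) (\<Sum>j\<in>J. g j))) ?G) ?S"
      unfolding avg_times good by (rule avg_swap)
    \<comment> \<open>For fixed \<open>g\<close> the shift \<open>a g\<close> disappears because
      \<open>f\<close> is uniform; only then does the law of the difference matter.\<close>
    also have "\<dots> = avg (\<lambda>g. avg (\<lambda>f. of_bool (Q f (\<Sum>j\<in>J. g j))) ?G) ?S"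
      unfolding a_def
      by (intro avg_cong avg_translate[where f = "\<lambda>f. of_bool (Q f _)"] Gdeg_add Gdeg_minus modG)
    also have "\<dots> = avg (\<lambda>g. avg (\<lambda>f. of_bool (Q f g)) ?G) ?G"
      by (rule avg_sum_coordinates[where f = "\<lambda>g. avg (\<lambda>f. of_bool (Q f g)) ?G"])
        (use J(1,2) finite_Gdeg in \<open>auto intro: Gdeg_add Gdeg_minus Gdeg_zero\<close>)
    also have "\<dots> = avg (\<lambda>(f, g). of_bool (Q f g)) (?G \<times> ?G)"
      unfolding avg_times by (subst avg_swap) simp
    finally show "\<theta> \<le> avg (\<lambda>(f, g). of_bool (\<forall>P\<in>F. f + (P * g) mod M \<in> A)) (?G \<times> ?G)"
      by (simp add: Q_def)
  qed
qed

text \<open>Since \<phi> is at most 1, the level set where it is at least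
  \<open>\<delta> / 2\<close> has density at least \<open>\<delta> / 2\<close>, and on each copy
  inside it the product is at least \<open>(\<delta> / 2) ^ card ?F\<close>.\<close>

theorem mainTheorem2:
  fixes fN :: "nat \<Rightarrow> 'a::{finite,field} poly" and k :: nat
  assumes "k \<ge> 1"
    and "\<forall>N\<ge>1. lead_coeff (fN N) = 1 \<and> irreducible (fN N) \<and> degree (fN N) = N"
  shows "\<forall>\<delta>::real>0. \<exists>c::real>0. \<forall>N\<ge>k. \<forall>\<phi>::'a poly \<Rightarrow> real.
           ((\<forall>x\<in>Gdeg N. 0 \<le> \<phi> x \<and> \<phi> x \<le> 1) \<and> avg \<phi> (Gdeg N) \<ge> \<delta>)
           \<longrightarrow> avg (\<lambda>(f, g). \<Prod>P\<in>Gdeg k. \<phi> (f + (P * g) mod fN N)) (Gdeg N \<times> Gdeg N) \<ge> c"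
proof (intro allI impI)
  fix \<delta> :: real assume \<delta>: "\<delta> > 0"
  let ?F = "Gdeg k :: 'a poly set"
  have neF: "?F \<noteq> {}" using Gdeg_zero by auto
  obtain \<theta> where \<theta>: "\<theta> > 0" and copies: "\<forall>(M::'a poly) A N. 1 \<le> N \<longrightarrow> degree M = N \<longrightarrow>
      \<delta> / 2 \<le> avg (\<lambda>x. of_bool (x \<in> A)) (Gdeg N) \<longrightarrow>
      \<theta> \<le> avg (\<lambda>(f, g). of_bool (\<forall>P\<in>?F. f + (P * g) mod M \<in> A)) (Gdeg N \<times> Gdeg N)"
    using homothetic_copies[OF finite_Gdeg neF half_gt_zero[OF \<delta>]] by blast
  define b where "b = (\<delta> / 2) ^ card ?F"
  have b: "b > 0" using \<delta> by (simp add: b_def)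
  show "\<exists>c::real>0. \<forall>N\<ge>k. \<forall>\<phi>::'a poly \<Rightarrow> real.
           ((\<forall>x\<in>Gdeg N. 0 \<le> \<phi> x \<and> \<phi> x \<le> 1) \<and> avg \<phi> (Gdeg N) \<ge> \<delta>)
           \<longrightarrow> avg (\<lambda>(f, g). \<Prod>P\<in>Gdeg k. \<phi> (f + (P * g) mod fN N)) (Gdeg N \<times> Gdeg N) \<ge> c"
  proof (intro exI[of _ "b * \<theta>"] conjI allI impI)
    show "b * \<theta> > 0" using b \<theta> by simp
    fix N and \<phi> :: "'a poly \<Rightarrow> real"
    assume "k \<le> N" and "(\<forall>x\<in>Gdeg N. 0 \<le> \<phi> x \<and> \<phi> x \<le> 1) \<and> avg \<phi> (Gdeg N) \<ge> \<delta>"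
    then have N: "1 \<le> N" and \<phi>: "\<And>x. x \<in> Gdeg N \<Longrightarrow> 0 \<le> \<phi> x" "\<And>x. x \<in> Gdeg N \<Longrightarrow> \<phi> x \<le> 1"
      and dens: "\<delta> \<le> avg \<phi> (Gdeg N)" using assms(1) by auto
    have deg: "degree (fN N) = N" using assms(2) N by blast
    let ?G = "Gdeg N :: 'a poly set"
    define A where "A = {x. \<delta> / 2 \<le> \<phi> x}"
    have neG: "?G \<noteq> {}" using Gdeg_zero by auto
    have "\<delta> \<le> avg (\<lambda>x. \<delta> / 2 + of_bool (x \<in> A)) ?G"
    proof (rule order_trans[OF dens avg_mono])
      fix x :: "'a poly" assume "x \<in> ?G"
      then show "\<phi> x \<le> \<delta> / 2 + of_bool (x \<in> A)"
        using \<phi>(2)[of x] \<delta> by (auto simp: A_def of_bool_def)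
    qed
    also have "\<dots> = \<delta> / 2 + avg (\<lambda>x. of_bool (x \<in> A)) ?G"
      using neG by (simp add: avg_add avg_const finite_Gdeg)
    finally have "\<delta> / 2 \<le> avg (\<lambda>x. of_bool (x \<in> A)) ?G" by simp
    with copies N deg have
      "\<theta> \<le> avg (\<lambda>(f, g). of_bool (\<forall>P\<in>?F. f + (P * g) mod fN N \<in> A)) (?G \<times> ?G)" by blast
    then have "b * \<theta> \<le> b * avg (\<lambda>(f, g). of_bool (\<forall>P\<in>?F. f + (P * g) mod fN N \<in> A)) (?G \<times> ?G)"
      using b by simp
    also have "\<dots> = avg (\<lambda>p. b * (case p of (f, g) \<Rightarrow> of_bool (\<forall>P\<in>?F. f + (P * g) mod fN N \<in> A)))
        (?G \<times> ?G)"
      by (rule avg_cmult[symmetric])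
    also have "\<dots> \<le> avg (\<lambda>(f, g). \<Prod>P\<in>?F. \<phi> (f + (P * g) mod fN N)) (?G \<times> ?G)"
    proof (rule avg_mono, clarify)
      fix f g :: "'a poly" assume f: "f \<in> ?G" and "g \<in> ?G"
      \<comment> \<open>Nonnegativity of \<phi> is only known on \<open>Gdeg N\<close>, so the
        points of the copy must stay there.\<close>
      have mem: "f + (P * g) mod fN N \<in> ?G" for P
        using f mod_in_Gdeg[OF deg N] by (rule Gdeg_add)
      show "b * of_bool (\<forall>P\<in>?F. f + (P * g) mod fN N \<in> A) \<le> (\<Prod>P\<in>?F. \<phi> (f + (P * g) mod fN N))"
      proof (cases "\<forall>P\<in>?F. f + (P * g) mod fN N \<in> A")
        case True
        then have "(\<Prod>P\<in>?F. \<delta> / 2) \<le> (\<Prod>P\<in>?F. \<phi> (f + (P * g) mod fN N))"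
          using \<delta> by (intro prod_mono) (auto simp: A_def)
        then show ?thesis using True by (simp add: b_def)
      next
        case False
        then show ?thesis using \<phi>(1) mem by (auto intro!: prod_nonneg)
      qed
    qed
    finally show "b * \<theta> \<le> avg (\<lambda>(f, g). \<Prod>P\<in>Gdeg k. \<phi> (f + (P * g) mod fN N)) (?G \<times> ?G)" .
  qed
qed

end
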